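(* Let $\mathscr{M}$ be a von Neumann algebra acting on the Hilbert space $\mathcal{H}$ and let $T_1, T_2 \in \mathscr{M}_{\mathrm{aff}}$. Let $A_1,B_1,A_2,B_2\in\mathscr{M}$, with $\mathrm{null}(B_i)\subseteq\mathrm{null}(A_i)$ for $i=1,2$, be such that $T_1 = A_1/B_1$ and $T_2 = A_2/B_2$. Then: (i) $T_1+T_2$ is in $\mathscr{M}_{\mathrm{aff}}$ with quotient representation $A/B$ (where $A,B\in\mathscr{M}$ and $\mathrm{null}(B)\subseteq\mathrm{null}(A)$), where $$A = (A_1/B_1)(B_1\boxdot B_2) + (A_2/B_2)(B_1\boxdot B_2),\qquad B = B_1\boxdot B_2.$$ (ii) $T_1T_2$ is in $\mathscr{M}_{\mathrm{aff}}$ with quotient representation $A/B$ (where $A,B\in\mathscr{M}$ and $\mathrm{null}(B)\subseteq\mathrm{null}(A)$), where $$A = (A_1/B_1)\big(A_2\,(A_2\circledcirc B_1)\big),\qquad B = B_2\,(A_2\circledcirc B_1).$$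
   Context: An unbounded operator on $\mathcal{H}$ is a linear map $T:\mathrm{dom}(T)\to\mathcal{H}$ with $\mathrm{dom}(T)$ a (not necessarily dense) linear subspace of $\mathcal{H}$, and $T$ not necessarily bounded; equality of operators includes equality of domains. For $A,B\in\mathcal{B}(\mathcal{H})$ with $\mathrm{null}(B)\subseteq\mathrm{null}(A)$, the quotient $A/B$ is the unbounded operator with domain $\mathrm{ran}(B)$ given by $Bx\mapsto Ax$ ($x\in\mathcal{H}$). The set of affiliated operators is $\mathscr{M}_{\mathrm{aff}} := \{A/B : A,B\in\mathscr{M},\ \mathrm{null}(B)\subseteq\mathrm{null}(A)\}$. Sums and products of unbounded operators: $\mathrm{dom}(S+T)=\mathrm{dom}(S)\cap\mathrm{dom}(T)$, $(S+T)x=Sx+Tx$; $\mathrm{dom}(ST)=\{x\in\mathrm{dom}(T): Tx\in\mathrm{dom}(S)\}$, $(ST)x=S(Tx)$. For $A,B\in\mathscr{M}$ let $\mathfrak{T}_{A,B}=\begin{bmatrix} A & -B\\ 0&0\end{bmatrix}\in M_2(\mathscr{M})$, acting on $\mathcal{H}\oplus\mathcal{H}$, let $\mathbf{N}(\mathfrak{T}_{A,B})$ be the orthogonal projection onto its nullspace, and let $\mathbf{N}(\mathfrak{T}_{A,B})_{11}\in\mathscr{M}$ be the $(1,1)$ entry of this projection. Define $$A\boxdot B := \sqrt{A\,\mathbf{N}(\mathfrak{T}_{A,B})_{11}A^*}\in\mathscr{M},\qquad A\circledcirc B := \sqrt{\mathbf{N}(\mathfrak{T}_{A,B})_{11}}\in\mathscr{M}.$$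 *)

theory Defs
  imports "HOL-Analysis.Analysis"
begin

section \<open>Complex Hilbert spaces\<close>

text \<open>The norm and the topology come from \<open>real_inner\<close>. By \<open>Re_cinner\<close> the norm is the one
  induced by \<open>cinner\<close>, so positivity and definiteness of \<open>cinner\<close> follow from those of \<open>inner\<close>.
  The inner product is linear in the first argument.\<close>

class complex_hilbert = real_inner + complete_space +
  fixes scaleC :: "complex \<Rightarrow> 'a \<Rightarrow> 'a" (infixr \<open>*\<^sub>C\<close> 75)
    and cinner :: "'a \<Rightarrow> 'a \<Rightarrow> complex"
  assumes scaleC_add_right: "c *\<^sub>C (x + y) = c *\<^sub>C x + c *\<^sub>C y"
    and scaleC_add_left: "(c + d) *\<^sub>C x = c *\<^sub>C x + d *\<^sub>C x"
    and scaleC_scaleC: "c *\<^sub>C d *\<^sub>C x = (c * d) *\<^sub>C x"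
    and scaleC_of_real: "complex_of_real r *\<^sub>C x = r *\<^sub>R x"
    and cinner_add_left: "cinner (x + y) z = cinner x z + cinner y z"
    and cinner_scaleC_left: "cinner (c *\<^sub>C x) y = c * cinner x y"
    and cinner_commute: "cinner x y = cnj (cinner y x)"
    and Re_cinner: "Re (cinner x y) = inner x y"

text \<open>The Hilbert space \<open>H \<oplus> H\<close> is the type \<open>'h \<times> 'h\<close>.\<close>

instantiation prod :: (complex_hilbert, complex_hilbert) complex_hilbert
begin

definition "c *\<^sub>C p = (c *\<^sub>C fst p, c *\<^sub>C snd p)"
definition "cinner p q = cinner (fst p) (fst q) + cinner (snd p) (snd q)"

instance
proof
  fix c d :: complex and r :: real and x y z :: "'a \<times> 'b"
  show "c *\<^sub>C (x + y) = c *\<^sub>C x + c *\<^sub>C y"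
    by (simp add: scaleC_prod_def scaleC_add_right)
  show "(c + d) *\<^sub>C x = c *\<^sub>C x + d *\<^sub>C x"
    by (simp add: scaleC_prod_def scaleC_add_left)
  show "c *\<^sub>C d *\<^sub>C x = (c * d) *\<^sub>C x"
    by (simp add: scaleC_prod_def scaleC_scaleC)
  show "complex_of_real r *\<^sub>C x = r *\<^sub>R x"
    by (simp add: scaleC_prod_def scaleC_of_real prod_eq_iff)
  show "cinner (x + y) z = cinner x z + cinner y z"
    by (simp add: cinner_prod_def cinner_add_left)
  show "cinner (c *\<^sub>C x) y = c * cinner x y"
    by (simp add: cinner_prod_def scaleC_prod_def cinner_scaleC_left algebra_simps)
  show "cinner x y = cnj (cinner y x)"
    unfolding cinner_prod_def complex_cnj_add
    by (intro arg_cong2[where f = "(+)"] cinner_commute)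
  show "Re (cinner x y) = inner x y"
    by (simp add: cinner_prod_def Re_cinner inner_prod_def)
qed

end

section \<open>Bounded operators\<close>

definition bounded_clinear :: "('a::complex_hilbert \<Rightarrow> 'b::complex_hilbert) \<Rightarrow> bool" where
  "bounded_clinear T \<longleftrightarrow> bounded_linear T \<and> (\<forall>c x. T (c *\<^sub>C x) = c *\<^sub>C T x)"

definition null :: "('a::complex_hilbert \<Rightarrow> 'b::complex_hilbert) \<Rightarrow> 'a set" where
  "null T = {x. T x = 0}"

definition cadjoint :: "('a::complex_hilbert \<Rightarrow> 'b::complex_hilbert) \<Rightarrow> 'b \<Rightarrow> 'a" where
  "cadjoint T = (THE S. \<forall>x y. cinner (T x) y = cinner x (S y))"

definition positive_op :: "('a::complex_hilbert \<Rightarrow> 'a) \<Rightarrow> bool" where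
  "positive_op T \<longleftrightarrow> bounded_clinear T \<and> (\<forall>x. cinner (T x) x \<in> \<real>\<^sub>\<ge>\<^sub>0)"

definition sqrt_op :: "('a::complex_hilbert \<Rightarrow> 'a) \<Rightarrow> 'a \<Rightarrow> 'a" where
  "sqrt_op T = (THE S. positive_op S \<and> S \<circ> S = T)"

definition orth_proj :: "'a::complex_hilbert set \<Rightarrow> 'a \<Rightarrow> 'a" where
  "orth_proj V x = (THE u. u \<in> V \<and> (\<forall>v\<in>V. cinner (x - u) v = 0))"

definition null_proj :: "('a::complex_hilbert \<Rightarrow> 'b::complex_hilbert) \<Rightarrow> 'a \<Rightarrow> 'a" where
  "null_proj T = orth_proj (null T)"

text \<open>A von Neumann algebra is a unital *-subalgebra of \<open>B(H)\<close> that is closed in the strong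
  operator topology. The topology of type \<open>'h \<Rightarrow> 'h\<close> is that of pointwise convergence in norm,
  hence the subspace topology on the bounded operators is the strong operator topology.\<close>

definition von_neumann_algebra :: "('h::complex_hilbert \<Rightarrow> 'h) set \<Rightarrow> bool" where
  "von_neumann_algebra M \<longleftrightarrow>
     M \<subseteq> Collect bounded_clinear \<and>
     id \<in> M \<and>
     (\<forall>S\<in>M. \<forall>T\<in>M. (\<lambda>x. S x + T x) \<in> M) \<and>
     (\<forall>c. \<forall>T\<in>M. (\<lambda>x. c *\<^sub>C T x) \<in> M) \<and>
     (\<forall>S\<in>M. \<forall>T\<in>M. S \<circ> T \<in> M) \<and>
     (\<forall>T\<in>M. cadjoint T \<in> M) \<and>
     closedin (top_of_set (Collect bounded_clinear)) M"

section \<open>Unbounded operators\<close>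

text \<open>An unbounded operator is a partial map whose domain \<open>dom T\<close> is a linear subspace and which
  is linear there; equality of partial maps includes equality of domains. The product \<open>ST\<close> is
  the composition \<open>S \<circ>\<^sub>m T\<close> of partial maps.\<close>

definition unbounded_operator :: "('h::complex_hilbert \<rightharpoonup> 'h) \<Rightarrow> bool" where
  "unbounded_operator T \<longleftrightarrow>
     T 0 = Some 0 \<and>
     (\<forall>x y u v. T x = Some u \<longrightarrow> T y = Some v \<longrightarrow> T (x + y) = Some (u + v)) \<and>
     (\<forall>c x u. T x = Some u \<longrightarrow> T (c *\<^sub>C x) = Some (c *\<^sub>C u))"

definition unb_add :: "('h::complex_hilbert \<rightharpoonup> 'h) \<Rightarrow> ('h \<rightharpoonup> 'h) \<Rightarrow> ('h \<rightharpoonup> 'h)" where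
  "unb_add S T = (\<lambda>x. if x \<in> dom S \<inter> dom T then Some (the (S x) + the (T x)) else None)"

definition everywhere :: "('h \<Rightarrow> 'h) \<Rightarrow> ('h \<rightharpoonup> 'h)" where
  "everywhere A = (\<lambda>x. Some (A x))"

text \<open>Meaningful only if \<open>null B \<subseteq> null A\<close>; the value at \<open>B x\<close> is then \<open>A x\<close>.\<close>

definition quotient :: "('h::complex_hilbert \<Rightarrow> 'h) \<Rightarrow> ('h \<Rightarrow> 'h) \<Rightarrow> ('h \<rightharpoonup> 'h)" where
  "quotient A B = (\<lambda>y. if y \<in> range B then Some (THE z. \<exists>x. B x = y \<and> A x = z) else None)"

lemma dom_quotient: "dom (quotient A B) = range B"
  by (auto simp: quotient_def dom_def)

lemma quotient_apply:
  assumes A: "bounded_clinear A" and B: "bounded_clinear B" and "null B \<subseteq> null A"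
  shows "quotient A B (B x) = Some (A x)"
proof -
  have linA: "linear A" and linB: "linear B"
    using A B by (auto simp: bounded_clinear_def intro: bounded_linear.linear)
  have "A x' = A x" if "B x' = B x" for x'
  proof -
    have "x' - x \<in> null B"
      using that by (simp add: null_def linear_diff[OF linB])
    then have "x' - x \<in> null A"
      using assms(3) by blast
    then show ?thesis
      by (simp add: null_def linear_diff[OF linA])
  qed
  then have same: "\<And>x'. B x' = B x \<Longrightarrow> A x' = A x" .
  have "(THE z. \<exists>x'. B x' = B x \<and> A x' = z) = A x"
  proof (rule the_equality)
    show "\<exists>x'. B x' = B x \<and> A x' = A x" by (intro exI[of _ x] conjI refl)
    show "z = A x" if "\<exists>x'. B x' = B x \<and> A x' = z" for z
      using that by (elim exE conjE) (drule same, simp only:)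
  qed
  then show ?thesis
    by (simp add: quotient_def)
qed

lemma unbounded_operator_quotient:
  assumes A: "bounded_clinear A" and B: "bounded_clinear B" and "null B \<subseteq> null A"
  shows "unbounded_operator (quotient A B)"
proof -
  note q = quotient_apply[OF assms]
  have linA: "linear A" and linB: "linear B"
    using A B by (auto simp: bounded_clinear_def intro: bounded_linear.linear)
  have ex: "\<exists>x. y = B x \<and> u = A x" if "quotient A B y = Some u" for y u
  proof -
    from that have "y \<in> range B"
      using dom_quotient[of A B] by blast
    then obtain x where "y = B x" by blast
    with that q[of x] show ?thesis by auto
  qed
  have "quotient A B 0 = Some 0"
    using q[of 0] by (simp add: linear_0[OF linA] linear_0[OF linB])
  moreover have "quotient A B (y + z) = Some (u + v)"
    if yu: "quotient A B y = Some u" and zv: "quotient A B z = Some v" for y z u v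
  proof -
    obtain a b where "y = B a" "u = A a" "z = B b" "v = A b"
      using ex[OF yu] ex[OF zv] by blast
    then show ?thesis
      using q[of "a + b"] by (simp add: linear_add[OF linA] linear_add[OF linB])
  qed
  moreover have "quotient A B (c *\<^sub>C y) = Some (c *\<^sub>C u)" if yu: "quotient A B y = Some u" for c y u
  proof -
    obtain a where "y = B a" "u = A a"
      using ex[OF yu] by blast
    then show ?thesis
      using q[of "c *\<^sub>C a"] A B by (simp add: bounded_clinear_def)
  qed
  ultimately show ?thesis
    by (simp add: unbounded_operator_def)
qed

definition affiliated :: "('h::complex_hilbert \<Rightarrow> 'h) set \<Rightarrow> ('h \<rightharpoonup> 'h) set" where
  "affiliated M = {quotient A B | A B. A \<in> M \<and> B \<in> M \<and> null B \<subseteq> null A}"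

section \<open>The operations on bounded operators\<close>

definition block_op ::
  "('h::complex_hilbert \<Rightarrow> 'h) \<Rightarrow> ('h \<Rightarrow> 'h) \<Rightarrow> ('h \<Rightarrow> 'h) \<Rightarrow> ('h \<Rightarrow> 'h) \<Rightarrow> 'h \<times> 'h \<Rightarrow> 'h \<times> 'h" where
  "block_op A B C D = (\<lambda>(x, y). (A x + B y, C x + D y))"

definition entry11 :: "('h::complex_hilbert \<times> 'h \<Rightarrow> 'h \<times> 'h) \<Rightarrow> 'h \<Rightarrow> 'h" where
  "entry11 T x = fst (T (x, 0))"

definition T_block :: "('h::complex_hilbert \<Rightarrow> 'h) \<Rightarrow> ('h \<Rightarrow> 'h) \<Rightarrow> 'h \<times> 'h \<Rightarrow> 'h \<times> 'h" where
  "T_block A B = block_op A (\<lambda>y. - B y) (\<lambda>_. 0) (\<lambda>_. 0)"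

definition boxdot :: "('h::complex_hilbert \<Rightarrow> 'h) \<Rightarrow> ('h \<Rightarrow> 'h) \<Rightarrow> 'h \<Rightarrow> 'h" (infixl \<open>\<boxdot>\<close> 70) where
  "A \<boxdot> B = sqrt_op (A \<circ> entry11 (null_proj (T_block A B)) \<circ> cadjoint A)"

definition circledcirc :: "('h::complex_hilbert \<Rightarrow> 'h) \<Rightarrow> ('h \<Rightarrow> 'h) \<Rightarrow> 'h \<Rightarrow> 'h" (infixl \<open>\<circledcirc>\<close> 70) where
  "A \<circledcirc> B = sqrt_op (entry11 (null_proj (T_block A B)))"

end

theory Submission
  imports Defs
begin

text \<open>
  Let \<open>P\<close> be the projection onto \<open>{(x, y). A x = B y}\<close>, so that \<open>K x = P (x, 0)\<close> satisfies
  \<open>K\<^sup>* K = P\<^sub>1\<^sub>1\<close> and \<open>G = A K\<^sup>*\<close> satisfies \<open>G G\<^sup>* = A P\<^sub>1\<^sub>1 A\<^sup>*\<close>. By Douglas' theorem a square root of \<open>G G\<^sup>*\<close>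
  has the range of \<open>G\<close>, which is \<open>ran A \<inter> ran B\<close>; likewise \<open>\<surd>P\<^sub>1\<^sub>1\<close> has the range of \<open>K\<^sup>*\<close>, which is
  \<open>{x. A x \<in> ran B}\<close>. These are the domains needed for sums and products. As \<open>A\<close> and \<open>B\<close> agree on the
  two components of \<open>P\<close>, one has \<open>\<parallel>G\<^sup>* y\<parallel> = \<parallel>P (A\<^sup>* y, 0)\<parallel> = \<parallel>P (0, B\<^sup>* y)\<parallel> \<le> \<parallel>B\<^sup>* y\<parallel>\<close>, so Douglas' theorem
  also factors \<open>A \<boxdot> B\<close> through \<open>A\<close> and \<open>B\<close>, and \<open>A (A \<circledcirc> B)\<close> through \<open>B\<close>, with bounded factors.
  Projections, square roots and Douglas factors are built as strong limits of polynomials in the given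
  operators and their adjoints, hence lie in the von Neumann algebra.
\<close>

section \<open>Adjoints on real Hilbert spaces\<close>

text \<open>Squared distances are what the parallelogram law and the inequality
  \<open>T\<^sup>2 \<le> T\<close> for positive contractions control; both convergence arguments
  below end here.\<close>

lemma Cauchy_norm_sq_bound:
  fixes X :: "nat \<Rightarrow> 'a::real_normed_vector" and e :: "nat \<Rightarrow> real"
  assumes e: "e \<longlonglongrightarrow> 0" and bound: "\<And>m n. m \<le> n \<Longrightarrow> (norm (X n - X m))\<^sup>2 \<le> e m"
  shows "Cauchy X"
proof (rule CauchyI')
  fix r :: real
  assume r: "0 < r"
  then have "\<forall>\<^sub>F m in sequentially. e m < r\<^sup>2"
    by (intro order_tendstoD(2)[OF e]) simp
  then obtain N where N: "\<And>m. m \<ge> N \<Longrightarrow> e m < r\<^sup>2"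
    by (auto simp: eventually_sequentially)
  have "dist (X m) (X n) < r" if "m \<ge> N" "m < n" for m n
    unfolding dist_norm
  proof (rule power2_less_imp_less)
    show "(norm (X m - X n))\<^sup>2 < r\<^sup>2"
      using bound[of m n] N[of m] that by (simp add: norm_minus_commute)
  qed (use r in simp)
  then show "\<exists>M. \<forall>m\<ge>M. \<forall>n>m. dist (X m) (X n) < r"
    by blast
qed

text \<open>The representing vector minimises \<open>\<parallel>z\<parallel>\<^sup>2 - 2 f z\<close>; by the parallelogram law every
  minimising sequence is Cauchy.\<close>

theorem riesz_representation:
  fixes f :: "'a::{real_inner,complete_space} \<Rightarrow> real"
  assumes "bounded_linear f"
  obtains z where "\<And>x. f x = inner z x"
proof -
  interpret f: bounded_linear f by fact
  define J where "J z = (norm z)\<^sup>2 - 2 * f z" for z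
  obtain K where K: "\<And>x. norm (f x) \<le> norm x * K"
    using f.bounded by blast
  have lower: "- K\<^sup>2 \<le> J z" for z
  proof -
    have "2 * f z \<le> 2 * (norm z * K)"
      using K[of z] by simp
    moreover have "0 \<le> (norm z - K)\<^sup>2" by simp
    ultimately show ?thesis
      by (simp add: J_def power2_diff)
  qed
  define m where "m = (INF z. J z)"
  have bdd: "bdd_below (range J)"
    using lower by (intro bdd_belowI2)
  have m: "m \<le> J z" for z
    unfolding m_def by (rule cINF_lower[OF bdd]) simp
  have "\<exists>z. J z < m + 1 / Suc n" for n
  proof -
    have "m < m + 1 / Suc n" by simp
    then show ?thesis
      unfolding m_def by (subst (asm) cINF_less_iff[OF _ bdd]) auto
  qed
  then obtain z where z: "\<And>n. J (z n) < m + 1 / Suc n"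
    by metis
  \<comment> \<open>The linear terms cancel, so this is the parallelogram law. As the midpoint value
    is at least \<open>m\<close>, two near-minimisers are close to each other.\<close>
  have par: "(norm (u - v))\<^sup>2 = 2 * J u + 2 * J v - 4 * J ((1/2) *\<^sub>R (u + v))" for u v
    by (simp add: J_def power2_norm_eq_inner f.scaleR f.add algebra_simps inner_commute)
  have "Cauchy z"
  proof (rule Cauchy_norm_sq_bound)
    show "(\<lambda>k. 4 * (1 / Suc k)) \<longlonglongrightarrow> 0"
      by (intro tendsto_mult_right_zero LIMSEQ_Suc[OF lim_1_over_n])
    fix k l :: nat
    assume "k \<le> l"
    then have "1 / Suc l \<le> 1 / Suc k"
      by (simp add: frac_le)
    then show "(norm (z l - z k))\<^sup>2 \<le> 4 * (1 / Suc k)"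
      using z[of k] z[of l] m[of "(1/2) *\<^sub>R (z l + z k)"] unfolding par by linarith
  qed
  then obtain w where w: "z \<longlonglongrightarrow> w"
    using Cauchy_convergent convergent_def by blast
  have "(\<lambda>n. J (z n)) \<longlonglongrightarrow> J w"
    unfolding J_def by (intro tendsto_intros w f.tendsto)
  moreover have "(\<lambda>n. m + 1 / Suc n) \<longlonglongrightarrow> m + 0"
    by (intro tendsto_intros LIMSEQ_Suc[OF lim_1_over_n])
  ultimately have Jw: "J w \<le> m"
    using z by (intro LIMSEQ_le) (auto intro: less_imp_le)
  have "f x = inner w x" for x
  proof (rule ccontr)
    assume neq: "f x \<noteq> inner w x"
    define d where "d = inner w x - f x"
    have x: "inner x x > 0"
      using neq by (cases "x = 0") (auto simp: f.zero)
    \<comment> \<open>This \<open>t\<close> minimises \<open>J\<close> on the line through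
      \<open>w\<close> in direction \<open>x\<close>; there \<open>J\<close> falls below
      \<open>J w\<close> by \<open>d\<^sup>2 / inner x x\<close>, contradicting minimality.\<close>
    define t where "t = - d / inner x x"
    have "(norm (w + t *\<^sub>R x))\<^sup>2 = (norm w)\<^sup>2 + 2 * t * inner w x + t\<^sup>2 * inner x x"
      unfolding power2_norm_eq_inner
      by (simp add: inner_commute algebra_simps power2_eq_square)
    then have "J (w + t *\<^sub>R x) = J w + 2 * t * d + t\<^sup>2 * inner x x"
      by (simp add: J_def d_def f.scaleR f.add algebra_simps)
    also have "\<dots> = J w - d\<^sup>2 / inner x x"
      using x by (simp add: t_def power2_eq_square field_simps)
    also have "\<dots> < J w"
      using x neq by (simp add: d_def)
    also have "\<dots> \<le> J (w + t *\<^sub>R x)"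
      using Jw m order.trans by blast
    finally show False by simp
  qed
  then show thesis
    by (rule that)
qed

text \<open>\<open>adjoint\<close> is a Hilbert choice, so its identity needs the existence of some
  adjoint; Riesz applied to each functional \<open>inner (T x) y\<close> in \<open>x\<close>
  supplies one.\<close>

lemma adjoint_hilbert:
  fixes T :: "'a::{real_inner,complete_space} \<Rightarrow> 'b::real_inner"
  assumes "bounded_linear T"
  shows "inner (T x) y = inner x (adjoint T y)"
proof -
  have "\<exists>z. \<forall>x. inner (T x) y = inner x z" for y
  proof -
    have "bounded_linear (\<lambda>x. inner (T x) y)"
      by (rule bounded_linear_compose[OF bounded_linear_inner_left assms])
    then show ?thesis
      by (rule riesz_representation) (metis inner_commute)
  qed
  then obtain S where S: "\<forall>x y. inner (T x) y = inner x (S y)"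
    by metis
  then show ?thesis
    using adjoint_unique[OF S] by simp
qed

lemma adjoint_hilbert_left:
  fixes T :: "'a::{real_inner,complete_space} \<Rightarrow> 'b::real_inner"
  shows "bounded_linear T \<Longrightarrow> inner (adjoint T y) x = inner y (T x)"
  using adjoint_hilbert[of T x y] by (simp add: inner_commute)

text \<open>Boundedness: the adjoint identity at \<open>x = adjoint T y\<close> bounds the square of
  \<open>norm (adjoint T y)\<close> by \<open>norm (adjoint T y) * K * norm y\<close>, and one
  factor cancels.\<close>

lemma bounded_linear_adjoint:
  fixes T :: "'a::{real_inner,complete_space} \<Rightarrow> 'b::real_inner"
  assumes "bounded_linear T"
  shows "bounded_linear (adjoint T)"
proof -
  note adj = adjoint_hilbert[OF assms]
  obtain K where K: "0 < K" "\<And>x. norm (T x) \<le> norm x * K"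
    using bounded_linear.pos_bounded[OF assms] by blast
  show ?thesis
  proof (rule bounded_linear_intro)
    show "adjoint T (x + y) = adjoint T x + adjoint T y" for x y
      by (rule vector_eq_ldot[THEN iffD1]) (simp add: inner_add_right flip: adj)
    show "adjoint T (r *\<^sub>R x) = r *\<^sub>R adjoint T x" for r x
      by (rule vector_eq_ldot[THEN iffD1]) (simp flip: adj)
    fix y
    have "(norm (adjoint T y))\<^sup>2 = inner (T (adjoint T y)) y"
      by (simp add: adj power2_norm_eq_inner)
    also have "\<dots> \<le> norm (T (adjoint T y)) * norm y"
      by (rule norm_cauchy_schwarz)
    also have "\<dots> \<le> norm (adjoint T y) * K * norm y"
      by (intro mult_right_mono K(2)) simp
    finally have *: "norm (adjoint T y) * norm (adjoint T y) \<le> norm (adjoint T y) * (norm y * K)"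
      by (simp add: power2_eq_square mult_ac)
    show "norm (adjoint T y) \<le> norm y * K"
      using * K(1) by (cases "adjoint T y = 0") auto
  qed
qed

lemma bounded_linear_pointwise_limit:
  fixes F :: "nat \<Rightarrow> 'a::real_normed_vector \<Rightarrow> 'b::real_normed_vector"
  assumes F: "\<And>n. bounded_linear (F n)"
    and bound: "\<And>n x. norm (F n x) \<le> norm x * K"
    and lim: "\<And>x. (\<lambda>n. F n x) \<longlonglongrightarrow> L x"
  shows "bounded_linear L"
proof (rule bounded_linear_intro)
  show "L (x + y) = L x + L y" for x y
  proof (rule LIMSEQ_unique[OF lim])
    show "(\<lambda>n. F n (x + y)) \<longlonglongrightarrow> L x + L y"
      using tendsto_add[OF lim[of x] lim[of y]]
      by (simp add: linear_add[OF bounded_linear.linear[OF F]])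
  qed
  show "L (r *\<^sub>R x) = r *\<^sub>R L x" for r x
  proof (rule LIMSEQ_unique[OF lim])
    show "(\<lambda>n. F n (r *\<^sub>R x)) \<longlonglongrightarrow> r *\<^sub>R L x"
      using tendsto_scaleR[OF tendsto_const lim[of x], of r]
      by (simp add: linear_scale[OF bounded_linear.linear[OF F]])
  qed
  show "norm (L x) \<le> norm x * K" for x
    using bound by (intro LIMSEQ_le_const2[OF tendsto_norm[OF lim]]) auto
qed

section \<open>Positive operators on a real Hilbert space\<close>

text \<open>Symmetry is a separate clause: over the reals it does not follow from nonnegativity of
  the quadratic form.\<close>

definition psd :: "('a::real_inner \<Rightarrow> 'a) \<Rightarrow> bool" where
  "psd T \<longleftrightarrow> bounded_linear T \<and> (\<forall>x y. inner (T x) y = inner x (T y)) \<and> (\<forall>x. 0 \<le> inner (T x) x)"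

text \<open>The operator interval from 0 to the identity.\<close>

definition positive_contraction :: "('a::real_inner \<Rightarrow> 'a) \<Rightarrow> bool" where
  "positive_contraction T \<longleftrightarrow> psd T \<and> (\<forall>x. inner (T x) x \<le> inner x x)"

lemma psd_bounded_linear: "psd T \<Longrightarrow> bounded_linear T"
  by (simp add: psd_def)

lemma psd_sym: "psd T \<Longrightarrow> inner (T x) y = inner x (T y)"
  by (simp add: psd_def)

lemma psd_nonneg: "psd T \<Longrightarrow> 0 \<le> inner (T x) x"
  unfolding psd_def by blast

lemma positive_contraction_psd: "positive_contraction T \<Longrightarrow> psd T"
  by (simp add: positive_contraction_def)

lemma positive_contraction_le: "positive_contraction T \<Longrightarrow> inner (T x) x \<le> inner x x"
  by (simp add: positive_contraction_def)

lemmas positive_contraction_linear = bounded_linear.linear[OF psd_bounded_linear[OF positive_contraction_psd]]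

text \<open>The form \<open>inner (T x) y\<close> is a possibly degenerate inner product, so the
  discriminant argument on the line \<open>x + r *\<^sub>R y\<close> applies.\<close>

lemma psd_cauchy_schwarz:
  assumes "psd T"
  shows "(inner (T x) y)\<^sup>2 \<le> inner (T x) x * inner (T y) y"
proof -
  note lin = bounded_linear.linear[OF psd_bounded_linear[OF assms]]
  define a where "a = inner (T x) x"
  define b where "b = inner (T x) y"
  define c where "c = inner (T y) y"
  have q: "0 \<le> a + 2 * r * b + r\<^sup>2 * c" for r
  proof -
    have "inner (T y) x = b"
      unfolding b_def by (metis psd_sym[OF assms] inner_commute)
    then have "inner (T (x + r *\<^sub>R y)) (x + r *\<^sub>R y) = a + 2 * r * b + r\<^sup>2 * c"
      by (simp add: a_def b_def c_def linear_add[OF lin] linear_scale[OF lin]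
          inner_add_left inner_add_right power2_eq_square algebra_simps)
    then show ?thesis
      using psd_nonneg[OF assms] by metis
  qed
  have "b\<^sup>2 \<le> a * c"
  proof (cases "c = 0")
    case True
    \<comment> \<open>The polynomial in \<open>r\<close> is now affine; for nonzero \<open>b\<close>
      it would take the value -1 at the chosen \<open>r\<close>.\<close>
    have "b = 0"
      using q[of "- (a + 1) / (2 * b)"] True by (cases "b = 0") (auto simp: field_simps)
    with True show ?thesis by simp
  next
    case False
    then have c: "c > 0"
      using psd_nonneg[OF assms, of y] by (simp add: c_def)
    \<comment> \<open>The point \<open>r = - b / c\<close> is the minimiser of the
      quadratic.\<close>
    have "a + 2 * (- b / c) * b + (- b / c)\<^sup>2 * c = (a * c - b\<^sup>2) / c"
      using c by (simp add: power2_eq_square field_simps)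
    then have "0 \<le> (a * c - b\<^sup>2) / c"
      using q by metis
    with c show ?thesis
      by (simp add: zero_le_divide_iff)
  qed
  then show ?thesis
    by (simp add: a_def b_def c_def)
qed

text \<open>In operator terms, \<open>T\<^sup>2 \<le> T\<close>. Cauchy-Schwarz for the form of
  \<open>T\<close> at \<open>x\<close> and \<open>T x\<close>, then \<open>T \<le> 1\<close> at
  \<open>T x\<close>, leave a common factor to cancel.\<close>

lemma positive_contraction_norm_sq:
  assumes "positive_contraction T"
  shows "(norm (T x))\<^sup>2 \<le> inner (T x) x"
proof -
  have "(norm (T x))\<^sup>2 * (norm (T x))\<^sup>2 = (inner (T x) (T x))\<^sup>2"
    by (metis power2_norm_eq_inner power2_eq_square)
  also have "\<dots> \<le> inner (T x) x * inner (T (T x)) (T x)"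
    by (rule psd_cauchy_schwarz[OF positive_contraction_psd[OF assms]])
  also have "\<dots> \<le> inner (T x) x * (norm (T x))\<^sup>2"
    unfolding power2_norm_eq_inner
    by (intro mult_left_mono positive_contraction_le assms psd_nonneg positive_contraction_psd)
  finally have "(norm (T x))\<^sup>2 * (norm (T x))\<^sup>2 \<le> inner (T x) x * (norm (T x))\<^sup>2" .
  then show ?thesis
    using mult_right_le_imp_le[of "(norm (T x))\<^sup>2" "(norm (T x))\<^sup>2" "inner (T x) x"]
    by (cases "T x = 0") simp_all
qed

lemma positive_contraction_norm:
  assumes "positive_contraction T"
  shows "norm (T x) \<le> norm x"
proof (rule power2_le_imp_le)
  have "(norm (T x))\<^sup>2 \<le> inner x x"
    using positive_contraction_norm_sq[OF assms] positive_contraction_le[OF assms] by (rule order.trans)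
  then show "(norm (T x))\<^sup>2 \<le> (norm x)\<^sup>2"
    by (simp add: power2_norm_eq_inner)
qed simp

lemma positive_contraction_complement:
  assumes "positive_contraction T"
  shows "positive_contraction (\<lambda>x. x - T x)"
  using assms
  by (auto simp: positive_contraction_def psd_def inner_diff_left inner_diff_right
      intro: bounded_linear_sub bounded_linear_ident)

lemma positive_contraction_scaled:
  assumes "psd T" and "\<And>x. norm (T x) \<le> norm x * K" and "0 < K"
  shows "positive_contraction (\<lambda>x. (1/K) *\<^sub>R T x)"
proof -
  have "inner (T x) x \<le> K * inner x x" for x
  proof -
    have "inner (T x) x \<le> norm (T x) * norm x"
      by (rule norm_cauchy_schwarz)
    also have "\<dots> \<le> (norm x * K) * norm x"
      by (intro mult_right_mono assms(2)) simp
    finally show ?thesis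
      by (simp add: power2_norm_eq_inner[symmetric] power2_eq_square mult_ac)
  qed
  then show ?thesis
    using assms
    by (auto simp: positive_contraction_def psd_def field_simps
        intro: bounded_linear_compose[OF bounded_linear_scaleR_right])
qed

section \<open>Strong limits of positive contractions\<close>

lemma positive_contraction_limit:
  assumes F: "\<And>n. positive_contraction (F n)" and lim: "\<And>x. (\<lambda>n. F n x) \<longlonglongrightarrow> L x"
  shows "positive_contraction L"
  unfolding positive_contraction_def psd_def
proof (intro conjI allI)
  show "bounded_linear L"
    using F by (intro bounded_linear_pointwise_limit[OF _ _ lim, where K = 1])
      (simp_all add: positive_contraction_norm psd_bounded_linear positive_contraction_psd)
  show "inner (L x) y = inner x (L y)" for x y
  proof (rule LIMSEQ_unique)
    show "(\<lambda>n. inner (F n x) y) \<longlonglongrightarrow> inner (L x) y"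
      by (intro tendsto_intros lim)
    show "(\<lambda>n. inner (F n x) y) \<longlonglongrightarrow> inner x (L y)"
      unfolding psd_sym[OF positive_contraction_psd[OF F]] by (intro tendsto_intros lim)
  qed
  have *: "(\<lambda>n. inner (F n x) x) \<longlonglongrightarrow> inner (L x) x" for x
    by (intro tendsto_intros lim)
  show "0 \<le> inner (L x) x" for x
    by (rule LIMSEQ_le_const[OF *]) (simp add: psd_nonneg positive_contraction_psd F)
  show "inner (L x) x \<le> inner x x" for x
    by (rule LIMSEQ_le_const2[OF *]) (simp add: positive_contraction_le F)
qed

text \<open>For \<open>m \<le> n\<close> the difference \<open>F n - F m\<close> is again a positive
  contraction, so its squared norm at \<open>x\<close> is at most the increment of the bounded
  increasing scalars \<open>inner (F n x) x\<close>.\<close>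

lemma increasing_positive_contractions_converge:
  fixes F :: "nat \<Rightarrow> 'a::{real_inner,complete_space} \<Rightarrow> 'a"
  assumes F: "\<And>n. positive_contraction (F n)"
    and mono: "\<And>n x. inner (F n x) x \<le> inner (F (Suc n) x) x"
  obtains L where "positive_contraction L" and "\<And>x. (\<lambda>n. F n x) \<longlonglongrightarrow> L x"
proof -
  have "convergent (\<lambda>n. F n x)" for x
  proof -
    define a where "a n = inner (F n x) x" for n
    have inc: "inner (F m y) y \<le> inner (F n y) y" if "m \<le> n" for m n y
      using lift_Suc_mono_le[of "\<lambda>n. inner (F n y) y", OF mono that] .
    have "incseq a"
      unfolding incseq_def a_def using inc by blast
    moreover have "a n \<le> inner x x" for n
      by (simp add: a_def positive_contraction_le F)
    ultimately obtain l where l: "a \<longlonglongrightarrow> l" "\<forall>n. a n \<le> l"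
      using incseq_convergent[of a "inner x x"] by blast
    have "Cauchy (\<lambda>n. F n x)"
    proof (rule Cauchy_norm_sq_bound)
      show "(\<lambda>n. l - a n) \<longlonglongrightarrow> 0"
        using tendsto_diff[OF tendsto_const[of l] l(1)] by simp
      fix m n :: nat
      assume mn: "m \<le> n"
      have "positive_contraction (\<lambda>y. F n y - F m y)"
        unfolding positive_contraction_def psd_def
      proof (intro conjI allI)
        show "bounded_linear (\<lambda>y. F n y - F m y)"
          by (intro bounded_linear_sub psd_bounded_linear positive_contraction_psd F)
        show "inner (F n y - F m y) z = inner y (F n z - F m z)" for y z
          by (simp add: inner_diff_left inner_diff_right psd_sym positive_contraction_psd F)
        show "0 \<le> inner (F n y - F m y) y" for y
          using inc[OF mn, of y] by (simp add: inner_diff_left)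
        show "inner (F n y - F m y) y \<le> inner y y" for y
          using positive_contraction_le[OF F[of n], of y]
            psd_nonneg[OF positive_contraction_psd[OF F[of m]], of y]
          by (simp add: inner_diff_left)
      qed
      then have "(norm (F n x - F m x))\<^sup>2 \<le> inner (F n x - F m x) x"
        by (rule positive_contraction_norm_sq)
      also have "\<dots> \<le> l - a m"
        using l(2)[rule_format, of n] by (simp add: a_def inner_diff_left)
      finally show "(norm (F n x - F m x))\<^sup>2 \<le> l - a m" .
    qed
    then show ?thesis
      by (rule Cauchy_convergent)
  qed
  then have lim: "(\<lambda>n. F n x) \<longlonglongrightarrow> lim (\<lambda>n. F n x)" for x
    by (simp add: convergent_LIMSEQ_iff)
  show thesis
    by (rule that[OF positive_contraction_limit[OF F lim] lim])
qed

text \<open>Functional calculus is only needed up to membership: every operator obtained below as a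
  pointwise limit of polynomials in \<open>S\<close> lies in each such algebra containing \<open>S\<close>. Applied to the
  commutant of an operator \<open>R\<close> this shows that the limit commutes with everything commuting with \<open>S\<close>.\<close>

definition sot_closed_algebra :: "('a::real_normed_vector \<Rightarrow> 'a) set \<Rightarrow> bool" where
  "sot_closed_algebra N \<longleftrightarrow>
     id \<in> N \<and>
     (\<forall>S\<in>N. \<forall>T\<in>N. (\<lambda>x. S x + T x) \<in> N) \<and>
     (\<forall>r. \<forall>T\<in>N. (\<lambda>x. r *\<^sub>R T x) \<in> N) \<and>
     (\<forall>S\<in>N. \<forall>T\<in>N. S \<circ> T \<in> N) \<and>
     (\<forall>F T. (\<forall>n::nat. F n \<in> N) \<and> (\<forall>x. (\<lambda>n. F n x) \<longlonglongrightarrow> T x) \<and> bounded_linear T \<longrightarrow> T \<in> N)"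

context
  fixes N :: "('a::real_normed_vector \<Rightarrow> 'a) set"
  assumes N: "sot_closed_algebra N"
begin

lemma sot_id: "id \<in> N"
  using N by (simp add: sot_closed_algebra_def)

lemma sot_add: "S \<in> N \<Longrightarrow> T \<in> N \<Longrightarrow> (\<lambda>x. S x + T x) \<in> N"
  using N by (simp add: sot_closed_algebra_def)

lemma sot_scale: "T \<in> N \<Longrightarrow> (\<lambda>x. r *\<^sub>R T x) \<in> N"
  using N by (simp add: sot_closed_algebra_def)

lemma sot_comp: "S \<in> N \<Longrightarrow> T \<in> N \<Longrightarrow> S \<circ> T \<in> N"
  using N by (simp add: sot_closed_algebra_def)

lemma sot_limit:
  assumes "\<And>n::nat. F n \<in> N" and "\<And>x. (\<lambda>n. F n x) \<longlonglongrightarrow> T x" and "bounded_linear T"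
  shows "T \<in> N"
proof -
  have "(\<forall>n::nat. F n \<in> N) \<and> (\<forall>x. (\<lambda>n. F n x) \<longlonglongrightarrow> T x) \<and> bounded_linear T"
    using assms by blast
  then show ?thesis
    using N unfolding sot_closed_algebra_def by blast
qed

lemma sot_diff: "S \<in> N \<Longrightarrow> T \<in> N \<Longrightarrow> (\<lambda>x. S x - T x) \<in> N"
  using sot_add[OF _ sot_scale[of T "-1"], of S] by simp

lemma sot_complement: "T \<in> N \<Longrightarrow> (\<lambda>x. x - T x) \<in> N"
  using sot_diff[OF sot_id, of T] by simp

lemma sot_power: "T \<in> N \<Longrightarrow> (T ^^ n) \<in> N"
  by (induction n) (simp_all add: sot_id sot_comp)

lemma sot_zero: "(\<lambda>x. 0) \<in> N"
  using sot_scale[OF sot_id, of 0] by simp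

lemma sot_sum: "(\<And>k. F k \<in> N) \<Longrightarrow> (\<lambda>x. \<Sum>k<n. F k x) \<in> N" for n :: nat
  by (induction n) (simp_all add: sot_zero sot_add)

end

lemma sot_closed_algebra_commutant:
  assumes "bounded_linear R"
  shows "sot_closed_algebra {T. \<forall>x. R (T x) = T (R x)}"
  unfolding sot_closed_algebra_def
proof (intro conjI allI ballI impI)
  interpret R: bounded_linear R by fact
  fix F and T :: "'a \<Rightarrow> 'a"
  assume F: "(\<forall>n::nat. F n \<in> {T. \<forall>x. R (T x) = T (R x)}) \<and>
    (\<forall>x. (\<lambda>n. F n x) \<longlonglongrightarrow> T x) \<and> bounded_linear T"
  have "R (T x) = T (R x)" for x
  proof (rule LIMSEQ_unique)
    show "(\<lambda>n. F n (R x)) \<longlonglongrightarrow> T (R x)"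
      using F by blast
    show "(\<lambda>n. F n (R x)) \<longlonglongrightarrow> R (T x)"
      using F R.tendsto[of "\<lambda>n. F n x" "T x"] by simp
  qed
  then show "T \<in> {T. \<forall>x. R (T x) = T (R x)}"
    by simp
qed (use assms in \<open>auto simp: linear_add linear_scale bounded_linear.linear\<close>)

section \<open>Powers of positive contractions\<close>

lemma funpow_sym:
  assumes "\<And>x y. inner (T x) y = inner x (T y)"
  shows "inner ((T ^^ n) x) y = inner x ((T ^^ n) y)"
proof (induction n arbitrary: x y)
  case (Suc n)
  have "inner ((T ^^ Suc n) x) y = inner ((T ^^ n) x) (T y)"
    by (simp add: assms)
  also have "\<dots> = inner x ((T ^^ Suc n) y)"
    by (simp add: Suc funpow_swap1)
  finally show ?case .
qed simp

lemma inner_funpow_add: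
  assumes "\<And>x y. inner (T x) y = inner x (T y)"
  shows "inner ((T ^^ (k + m)) x) x = inner ((T ^^ m) x) ((T ^^ k) x)"
  by (simp add: funpow_add funpow_sym[OF assms])

lemma bounded_linear_funpow:
  fixes T :: "'a::real_normed_vector \<Rightarrow> 'a"
  shows "bounded_linear T \<Longrightarrow> bounded_linear (T ^^ n)"
  by (induction n) (auto simp: id_def o_def intro: bounded_linear_compose)

text \<open>Splitting the exponent evenly, an even power has quadratic form
  \<open>(norm ((T ^^ k) x))\<^sup>2\<close>, and an odd one has that of \<open>T\<close> at
  \<open>(T ^^ k) x\<close>.\<close>

lemma psd_funpow:
  assumes "psd T"
  shows "psd (T ^^ n)"
  unfolding psd_def
proof (intro conjI allI)
  show "bounded_linear (T ^^ n)"
    by (rule bounded_linear_funpow[OF psd_bounded_linear[OF assms]])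
  note split = inner_funpow_add[of T, OF psd_sym[OF assms]]
  show "inner ((T ^^ n) x) y = inner x ((T ^^ n) y)" for x y
    by (rule funpow_sym[OF psd_sym[OF assms]])
  show "0 \<le> inner ((T ^^ n) x) x" for x
  proof (cases "even n")
    case True
    then obtain k where "n = k + k"
      by (metis evenE mult_2)
    then have "inner ((T ^^ n) x) x = inner ((T ^^ k) x) ((T ^^ k) x)"
      by (simp add: split)
    then show ?thesis by simp
  next
    case False
    then obtain k where "n = k + Suc k"
      by (metis oddE mult_2 add_Suc_right Suc_eq_plus1)
    then have "inner ((T ^^ n) x) x = inner (T ((T ^^ k) x)) ((T ^^ k) x)"
      using split[of k "Suc k" x] by simp
    then show ?thesis
      by (simp add: psd_nonneg[OF assms])
  qed
qed

text \<open>With \<open>y = (T ^^ k) x\<close>, the even case is \<open>T \<le> 1\<close> at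
  \<open>y\<close> and the odd case is \<open>T\<^sup>2 \<le> T\<close> at \<open>y\<close>.\<close>

lemma positive_contraction_funpow_decreasing:
  assumes "positive_contraction T"
  shows "inner ((T ^^ Suc n) x) x \<le> inner ((T ^^ n) x) x"
proof -
  note split = inner_funpow_add[of T, OF psd_sym[OF positive_contraction_psd[OF assms]]]
  show ?thesis
  proof (cases "even n")
    case True
    then obtain k where k: "n = k + k"
      by (metis evenE mult_2)
    define y where "y = (T ^^ k) x"
    have "inner ((T ^^ Suc n) x) x = inner (T y) y"
      using split[of k "Suc k" x] by (simp add: k y_def)
    also have "\<dots> \<le> inner y y"
      by (rule positive_contraction_le[OF assms])
    also have "\<dots> = inner ((T ^^ n) x) x"
      by (simp add: y_def k split)
    finally show ?thesis .
  next
    case False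
    then obtain k where k: "n = k + Suc k"
      by (metis oddE mult_2 add_Suc_right Suc_eq_plus1)
    define y where "y = (T ^^ k) x"
    have "inner ((T ^^ Suc n) x) x = inner (T y) (T y)"
      using split[of "Suc k" "Suc k" x] by (simp add: k y_def)
    also have "\<dots> \<le> inner (T y) y"
      using positive_contraction_norm_sq[OF assms] by (simp add: power2_norm_eq_inner)
    also have "\<dots> = inner ((T ^^ n) x) x"
      using split[of k "Suc k" x] by (simp add: k y_def)
    finally show ?thesis .
  qed
qed

text \<open>The powers of \<open>1 - S\<close> decrease to the orthogonal projection onto the kernel of \<open>S\<close>.\<close>

lemma kernel_projection:
  fixes S :: "'a::{real_inner,complete_space} \<Rightarrow> 'a"
  assumes S: "positive_contraction S"
  obtains P where "positive_contraction P"
    and "\<And>x. (\<lambda>n. ((\<lambda>x. x - S x) ^^ n) x) \<longlonglongrightarrow> P x"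
    and "\<And>x. S (P x) = 0" and "\<And>x. S x = 0 \<Longrightarrow> P x = x"
proof -
  define D where "D = (\<lambda>x. x - S x)"
  have D: "positive_contraction D"
    unfolding D_def by (rule positive_contraction_complement[OF S])
  have pow: "positive_contraction (D ^^ n)" for n
    unfolding positive_contraction_def
  proof (intro conjI allI)
    show "psd (D ^^ n)"
      by (rule psd_funpow[OF positive_contraction_psd[OF D]])
    show "inner ((D ^^ n) x) x \<le> inner x x" for x
      by (induction n) (auto intro: order.trans positive_contraction_funpow_decreasing[OF D] simp del: funpow.simps(2))
  qed
  \<comment> \<open>The powers of \<open>D\<close> decrease, so the convergence theorem for
    increasing sequences is applied to their complements.\<close>
  obtain L where L: "positive_contraction L" "\<And>x. (\<lambda>n. x - (D ^^ n) x) \<longlonglongrightarrow> L x"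
  proof (rule increasing_positive_contractions_converge[of "\<lambda>n x. x - (D ^^ n) x"])
    show "positive_contraction (\<lambda>x. x - (D ^^ n) x)" for n
      by (rule positive_contraction_complement[OF pow])
    show "inner (x - (D ^^ n) x) x \<le> inner (x - (D ^^ Suc n) x) x" for n x
      using positive_contraction_funpow_decreasing[OF D, of n x] by (simp add: inner_diff_left)
  qed blast
  define P where "P = (\<lambda>x. x - L x)"
  have lim: "(\<lambda>n. (D ^^ n) x) \<longlonglongrightarrow> P x" for x
    using tendsto_diff[OF tendsto_const[of x] L(2)[of x]] by (simp add: P_def)
  have "D (P x) = P x" for x
  proof (rule LIMSEQ_unique)
    show "(\<lambda>n. (D ^^ Suc n) x) \<longlonglongrightarrow> P x"
      using lim by (rule LIMSEQ_Suc)
    show "(\<lambda>n. (D ^^ Suc n) x) \<longlonglongrightarrow> D (P x)"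
      using bounded_linear.tendsto[OF psd_bounded_linear[OF positive_contraction_psd[OF D]] lim[of x]]
      by simp
  qed
  moreover have "P x = x" if "S x = 0" for x
  proof (rule LIMSEQ_unique[OF lim])
    have "(D ^^ n) x = x" for n
      by (induction n) (simp_all add: D_def that)
    then show "(\<lambda>n. (D ^^ n) x) \<longlonglongrightarrow> x"
      by simp
  qed
  ultimately show thesis
    using lim positive_contraction_complement[OF L(1)]
    by (intro that[of P]) (simp_all add: D_def P_def[symmetric])
qed

section \<open>Square roots\<close>

text \<open>Polynomials in \<open>X\<close> with nonnegative coefficients. They are positive
  whenever \<open>X\<close> is, which turns an algebraic identity for the square root iteration into
  monotonicity.\<close>

inductive_set power_cone :: "('a::real_vector \<Rightarrow> 'a) \<Rightarrow> ('a \<Rightarrow> 'a) set" for X where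
  power: "X ^^ k \<in> power_cone X"
| add: "f \<in> power_cone X \<Longrightarrow> g \<in> power_cone X \<Longrightarrow> (\<lambda>x. f x + g x) \<in> power_cone X"
| scale: "f \<in> power_cone X \<Longrightarrow> 0 \<le> r \<Longrightarrow> (\<lambda>x. r *\<^sub>R f x) \<in> power_cone X"

lemma power_cone_subset: "sot_closed_algebra N \<Longrightarrow> X \<in> N \<Longrightarrow> power_cone X \<subseteq> N"
proof
  fix f
  assume "sot_closed_algebra N" "X \<in> N" "f \<in> power_cone X"
  from this(3,1,2) show "f \<in> N"
    by induction (auto intro: sot_power sot_add sot_scale)
qed

lemma power_cone_linear:
  assumes "linear X" and "f \<in> power_cone X"
  shows "linear f"
  using assms(2)
proof induction
  case (power k)
  then show ?case
    by (induction k) (auto intro!: linearI simp: linear_add linear_scale assms(1))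
qed (auto intro: linear_compose_add linear_compose_scale_right)

lemma power_cone_comp:
  assumes X: "linear X" and f: "f \<in> power_cone X" and g: "g \<in> power_cone X"
  shows "f \<circ> g \<in> power_cone X"
  using f
proof induction
  case (power k)
  have lin: "linear (X ^^ k)"
    by (rule power_cone_linear[OF X power_cone.power])
  show ?case
    using g
  proof induction
    case (power l)
    then show ?case
      using power_cone.power[where X = X and k = "k + l"] by (simp only: funpow_add)
  next
    case (add f g)
    then show ?case
      using power_cone.add by (simp add: o_def linear_add[OF lin])
  next
    case (scale f r)
    then show ?case
      using power_cone.scale by (simp add: o_def linear_scale[OF lin])
  qed
qed (auto simp: o_def intro: power_cone.intros)

text \<open>Two passes through commutants: \<open>f\<close> lies in the commutant of
  \<open>X\<close>; hence \<open>X\<close>, and with it \<open>g\<close>, lies in the commutant of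
  \<open>f\<close>.\<close>

lemma power_cone_commute:
  fixes X :: "'a::real_normed_vector \<Rightarrow> 'a"
  assumes X: "bounded_linear X" and f: "f \<in> power_cone X" and g: "g \<in> power_cone X"
  shows "f (g x) = g (f x)"
proof -
  have comm: "h \<in> {T. \<forall>x. R (T x) = T (R x)}"
    if "bounded_linear R" "X \<in> {T. \<forall>x. R (T x) = T (R x)}" "h \<in> power_cone X" for R h
    using power_cone_subset[OF sot_closed_algebra_commutant[OF that(1)] that(2)] that(3) by blast
  have bl: "bounded_linear h" if "h \<in> power_cone X" for h
    using that
  proof induction
    case (power k)
    then show ?case by (rule bounded_linear_funpow[OF X])
  qed (auto intro: bounded_linear_add bounded_linear_compose[OF bounded_linear_scaleR_right])
  have "X (f y) = f (X y)" for y
    using comm[OF X _ f] by simp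
  then have "f (g x) = g (f x)"
    using comm[OF bl[OF f] _ g] by simp
  then show ?thesis .
qed

lemma psd_power_cone:
  assumes "psd X" and "f \<in> power_cone X"
  shows "psd f"
  using assms(2)
proof induction
  case (power k)
  then show ?case by (rule psd_funpow[OF assms(1)])
next
  case (add f g)
  then show ?case
    by (auto simp: psd_def inner_add_left inner_add_right intro: bounded_linear_add)
next
  case (scale f r)
  then show ?case
    by (auto simp: psd_def intro: bounded_linear_compose[OF bounded_linear_scaleR_right])
qed

text \<open>With \<open>X = 1 - S\<close>, the iteration \<open>Y\<^sub>0 = 0\<close>, \<open>Y\<^sub>n\<^sub>+\<^sub>1 = (X + Y\<^sub>n\<^sup>2) / 2\<close> increases to a solution of
  \<open>(1 - Y)\<^sup>2 = S\<close>: the differences \<open>Y\<^sub>n\<^sub>+\<^sub>1 - Y\<^sub>n\<close> are polynomials in \<open>X\<close> with nonnegative coefficients.\<close>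

fun sqrt_iter :: "('a::real_vector \<Rightarrow> 'a) \<Rightarrow> nat \<Rightarrow> 'a \<Rightarrow> 'a" where
  "sqrt_iter X 0 = (\<lambda>x. 0)"
| "sqrt_iter X (Suc n) = (\<lambda>x. (1/2) *\<^sub>R (X x + sqrt_iter X n (sqrt_iter X n x)))"

lemma sqrt_iter_cone:
  fixes X :: "'a::real_normed_vector \<Rightarrow> 'a"
  assumes X: "bounded_linear X"
  shows "sqrt_iter X n \<in> power_cone X"
    and "(\<lambda>x. sqrt_iter X (Suc n) x - sqrt_iter X n x) \<in> power_cone X"
proof -
  note lin = bounded_linear.linear[OF X]
  have Xc: "X \<in> power_cone X"
    using power_cone.power[where X = X and k = 1] by simp
  have cone: "sqrt_iter X n \<in> power_cone X" for n
  proof (induction n)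
    case 0
    then show ?case
      using power_cone.scale[OF Xc, of 0] by simp
  next
    case (Suc n)
    then show ?case
      using power_cone.scale[OF power_cone.add[OF Xc power_cone_comp[OF lin Suc Suc]], of "1/2"]
      by simp
  qed
  then show "sqrt_iter X n \<in> power_cone X" .
  show "(\<lambda>x. sqrt_iter X (Suc n) x - sqrt_iter X n x) \<in> power_cone X"
  proof (induction n)
    case 0
    then show ?case
      using power_cone.scale[OF Xc, of "1/2"] by simp
  next
    case (Suc n)
    let ?U = "sqrt_iter X (Suc n)" and ?V = "sqrt_iter X n"
    note linU = power_cone_linear[OF lin cone[of "Suc n"]] and linV = power_cone_linear[OF lin cone[of n]]
    \<comment> \<open>Difference of squares: the next increment is half the product of sum and
      difference of the two last iterates, which commute. Both factors are in the cone.\<close>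
    have "(\<lambda>x. sqrt_iter X (Suc (Suc n)) x - ?U x) =
        (\<lambda>x. (1/2) *\<^sub>R ((\<lambda>x. ?U x + ?V x) \<circ> (\<lambda>x. ?U x - ?V x)) x)"
    proof
      fix x
      have "?U (?V x) = ?V (?U x)"
        by (rule power_cone_commute[OF X cone cone])
      then have "((\<lambda>x. ?U x + ?V x) \<circ> (\<lambda>x. ?U x - ?V x)) x = ?U (?U x) - ?V (?V x)"
        by (simp only: o_apply linear_diff[OF linU] linear_diff[OF linV]) simp
      moreover have "sqrt_iter X (Suc (Suc n)) x - ?U x =
          (1/2) *\<^sub>R (X x + ?U (?U x)) - (1/2) *\<^sub>R (X x + ?V (?V x))"
        by (simp only: sqrt_iter.simps)
      ultimately show "sqrt_iter X (Suc (Suc n)) x - ?U x =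
          (1/2) *\<^sub>R ((\<lambda>x. ?U x + ?V x) \<circ> (\<lambda>x. ?U x - ?V x)) x"
        by (simp only:) (simp add: algebra_simps del: sqrt_iter.simps)
    qed
    then show ?case
      using power_cone.scale[OF power_cone_comp[OF lin power_cone.add[OF cone[of "Suc n"] cone[of n]] Suc], of "1/2"]
      by simp
  qed
qed

lemma positive_contraction_sqrt:
  fixes S :: "'a::{real_inner,complete_space} \<Rightarrow> 'a"
  assumes S: "positive_contraction S"
  obtains Z where "positive_contraction Z" and "\<And>x. Z (Z x) = S x"
    and "\<And>N. sot_closed_algebra N \<Longrightarrow> S \<in> N \<Longrightarrow> Z \<in> N"
proof -
  define X where "X = (\<lambda>x. x - S x)"
  have X: "positive_contraction X"
    unfolding X_def by (rule positive_contraction_complement[OF S])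
  note Xp = positive_contraction_psd[OF X]
  note Xb = psd_bounded_linear[OF Xp]
  let ?Y = "sqrt_iter X"
  have Yp: "psd (?Y n)" for n
    by (rule psd_power_cone[OF Xp sqrt_iter_cone(1)[OF Xb]])
  have Y: "positive_contraction (?Y n)" for n
  proof (induction n)
    case 0
    then show ?case
      using Yp[of 0] by (simp add: positive_contraction_def)
  next
    case (Suc n)
    \<comment> \<open>The iterate is the mean of \<open>X\<close> and a square, each at most the
      identity.\<close>
    have "inner (?Y (Suc n) x) x \<le> inner x x" for x
    proof -
      have "inner (?Y n (?Y n x)) x = (norm (?Y n x))\<^sup>2"
        by (simp add: psd_sym[OF Yp] power2_norm_eq_inner)
      also have "\<dots> \<le> inner x x"
        using positive_contraction_norm_sq[OF Suc, of x] positive_contraction_le[OF Suc, of x] by simp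
      finally show ?thesis
        using positive_contraction_le[OF X, of x] by (simp add: inner_add_left)
    qed
    then show ?case
      using Yp[of "Suc n"] unfolding positive_contraction_def by blast
  qed
  obtain L where L: "positive_contraction L" and lim: "\<And>x. (\<lambda>n. ?Y n x) \<longlonglongrightarrow> L x"
  proof (rule increasing_positive_contractions_converge[of ?Y, OF Y])
    show "inner (?Y n x) x \<le> inner (?Y (Suc n) x) x" for n x
      using psd_nonneg[OF psd_power_cone[OF Xp sqrt_iter_cone(2)[OF Xb, of n]], of x]
      by (simp add: inner_diff_left del: sqrt_iter.simps)
  qed blast
  have fixpoint: "L x = (1/2) *\<^sub>R (X x + L (L x))" for x
  proof (rule LIMSEQ_unique)
    show "(\<lambda>n. ?Y (Suc n) x) \<longlonglongrightarrow> L x"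
      by (rule LIMSEQ_Suc[OF lim])
    \<comment> \<open>Squares need not follow pointwise limits automatically; the uniform bound
      \<open>norm (?Y n v) \<le> norm v\<close> lets the inner argument be replaced by its
      limit.\<close>
    have "(\<lambda>n. ?Y n (?Y n x) - ?Y n (L x)) \<longlonglongrightarrow> 0"
    proof (rule Lim_null_comparison)
      show "\<forall>\<^sub>F n in sequentially. norm (?Y n (?Y n x) - ?Y n (L x)) \<le> norm (?Y n x - L x)"
      proof (rule always_eventually, rule allI)
        fix n
        have "?Y n (?Y n x) - ?Y n (L x) = ?Y n (?Y n x - L x)"
          by (simp add: linear_diff positive_contraction_linear[OF Y])
        then show "norm (?Y n (?Y n x) - ?Y n (L x)) \<le> norm (?Y n x - L x)"
          using positive_contraction_norm[OF Y] by simp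
      qed
      show "(\<lambda>n. norm (?Y n x - L x)) \<longlonglongrightarrow> 0"
        using lim by (simp add: LIM_zero tendsto_norm_zero)
    qed
    from tendsto_add[OF this lim[of "L x"]] have "(\<lambda>n. ?Y n (?Y n x)) \<longlonglongrightarrow> L (L x)"
      by simp
    then show "(\<lambda>n. ?Y (Suc n) x) \<longlonglongrightarrow> (1/2) *\<^sub>R (X x + L (L x))"
      unfolding sqrt_iter.simps by (intro tendsto_intros)
  qed
  define Z where "Z = (\<lambda>x. x - L x)"
  have "Z (Z x) = S x" for x
  proof -
    have "2 *\<^sub>R L x = X x + L (L x)"
      by (subst fixpoint) simp
    then show ?thesis
      by (simp add: Z_def X_def linear_diff[OF positive_contraction_linear[OF L]] scaleR_2 algebra_simps)
  qed
  moreover have "Z \<in> N" if N: "sot_closed_algebra N" "S \<in> N" for N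
  proof -
    have "X \<in> N"
      unfolding X_def by (rule sot_complement[OF N])
    then have "?Y n \<in> N" for n
      using power_cone_subset[OF N(1)] sqrt_iter_cone(1)[OF Xb] by blast
    then have "L \<in> N"
      using lim psd_bounded_linear[OF positive_contraction_psd[OF L]] by (rule sot_limit[OF N(1)])
    then show ?thesis
      unfolding Z_def by (rule sot_complement[OF N(1)])
  qed
  ultimately show thesis
    using positive_contraction_complement[OF L] that[of Z] by (simp add: Z_def)
qed

lemma psd_sqrt:
  fixes S :: "'a::{real_inner,complete_space} \<Rightarrow> 'a"
  assumes S: "psd S"
  obtains Z where "psd Z" and "\<And>x. Z (Z x) = S x"
    and "\<And>N. sot_closed_algebra N \<Longrightarrow> S \<in> N \<Longrightarrow> Z \<in> N"
proof -
  obtain K where K: "0 < K" "\<And>x. norm (S x) \<le> norm x * K"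
    using bounded_linear.pos_bounded[OF psd_bounded_linear[OF S]] by blast
  obtain Z where Z: "positive_contraction Z" "\<And>x. Z (Z x) = (1/K) *\<^sub>R S x"
    and ZN: "\<And>N. sot_closed_algebra N \<Longrightarrow> (\<lambda>x. (1/K) *\<^sub>R S x) \<in> N \<Longrightarrow> Z \<in> N"
    using positive_contraction_sqrt[OF positive_contraction_scaled[OF S K(2,1)]] by metis
  show thesis
  proof (rule that[of "\<lambda>x. sqrt K *\<^sub>R Z x"])
    show "psd (\<lambda>x. sqrt K *\<^sub>R Z x)"
      using positive_contraction_psd[OF Z(1)] K(1)
      by (auto simp: psd_def intro: bounded_linear_compose[OF bounded_linear_scaleR_right])
    show "sqrt K *\<^sub>R Z (sqrt K *\<^sub>R Z x) = S x" for x
      using K(1) by (simp add: linear_scale[OF positive_contraction_linear[OF Z(1)]] Z(2))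
    show "(\<lambda>x. sqrt K *\<^sub>R Z x) \<in> N" if "sot_closed_algebra N" "S \<in> N" for N
      by (intro sot_scale ZN that)
  qed
qed

text \<open>The constructed root \<open>Q\<close> lies in every strongly closed algebra containing
  the square, in particular in the commutant of any other root \<open>T\<close>, since
  \<open>T\<close> commutes with its own square. Commuting positive roots coincide, so all roots
  equal \<open>Q\<close>.\<close>

lemma psd_sqrt_unique:
  fixes R Z :: "'a::{real_inner,complete_space} \<Rightarrow> 'a"
  assumes R: "psd R" and Z: "psd Z" and eq: "\<And>x. R (R x) = Z (Z x)"
  shows "R = Z"
proof -
  have psd_zero: "T y = 0" if "psd T" "inner (T y) y = 0" for T :: "'a \<Rightarrow> 'a" and y
    using psd_cauchy_schwarz[OF that(1), of y "T y"] that(2) by simp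
  have linear: "linear T" if "psd T" for T :: "'a \<Rightarrow> 'a"
    using that by (simp add: psd_def bounded_linear.linear)
  \<comment> \<open>For \<open>y = T x - V x\<close> one has \<open>T y + V y = 0\<close>, so both
    quadratic forms vanish at \<open>y\<close>. Cauchy-Schwarz gives \<open>T y = V y = 0\<close>,
    and \<open>inner y y\<close> vanishes by symmetry.\<close>
  have commuting: "T = V"
    if T: "psd T" and V: "psd V" and sq: "\<And>x. T (T x) = V (V x)" and comm: "\<And>x. T (V x) = V (T x)"
    for T V :: "'a \<Rightarrow> 'a"
  proof
    fix x
    define y where "y = T x - V x"
    have "T y + V y = 0"
      by (simp add: y_def linear_diff linear T V sq comm)
    then have "inner (T y) y + inner (V y) y = 0"
      by (metis inner_add_left inner_zero_left)
    with psd_nonneg[OF T, of y] psd_nonneg[OF V, of y]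
    have "inner (T y) y = 0" "inner (V y) y = 0" by linarith+
    then have "T y = 0" "V y = 0"
      using psd_zero T V by blast+
    moreover have "inner y y = inner x (T y) - inner x (V y)"
      by (simp add: y_def inner_diff_left inner_diff_right psd_sym[OF T] psd_sym[OF V]
          linear_diff linear T V)
    ultimately show "T x = V x"
      by (simp add: y_def)
  qed
  have "psd (\<lambda>x. Z (Z x))"
    using psd_funpow[OF Z, of 2] by (simp add: numeral_2_eq_2 o_def)
  then obtain Q where Q: "psd Q" "\<And>x. Q (Q x) = Z (Z x)"
    and QN: "\<And>N. sot_closed_algebra N \<Longrightarrow> (\<lambda>x. Z (Z x)) \<in> N \<Longrightarrow> Q \<in> N"
    by (rule psd_sqrt) blast
  have "Q = T" if T: "psd T" and sq: "\<And>x. T (T x) = Z (Z x)" for T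
  proof (rule commuting[OF Q(1) T])
    show "Q (Q x) = T (T x)" for x
      by (simp add: Q(2) sq)
    have "(\<lambda>x. Z (Z x)) \<in> {U. \<forall>x. T (U x) = U (T x)}"
      by (simp flip: sq)
    then show "Q (T x) = T (Q x)" for x
      using QN[OF sot_closed_algebra_commutant[OF psd_bounded_linear[OF T]]] by simp
  qed
  then show ?thesis
    using R Z eq by metis
qed

section \<open>Factorisation by majorisation\<close>

lemma adjoint_adjoint_hilbert:
  fixes T :: "'a::{real_inner,complete_space} \<Rightarrow> 'b::real_inner"
  assumes "bounded_linear T"
  shows "adjoint (adjoint T) = T"
  by (rule adjoint_unique) (simp add: adjoint_hilbert_left[OF assms])

lemma psd_self_adjoint_product:
  fixes B :: "'a::{real_inner,complete_space} \<Rightarrow> 'b::{real_inner,complete_space}"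
  assumes B: "bounded_linear B"
  shows "psd (\<lambda>x. adjoint B (B x))" and "psd (\<lambda>y. B (adjoint B y))"
proof -
  have *: "psd (\<lambda>x. adjoint T (T x))" if T: "bounded_linear T"
    for T :: "'c::{real_inner,complete_space} \<Rightarrow> 'd::{real_inner,complete_space}"
    unfolding psd_def
  proof (intro conjI allI)
    show "bounded_linear (\<lambda>x. adjoint T (T x))"
      by (rule bounded_linear_compose[OF bounded_linear_adjoint[OF T] T])
    have eq: "inner (adjoint T (T x)) y = inner (T x) (T y)" for x y
      by (rule adjoint_hilbert_left[OF T])
    then show "inner (adjoint T (T x)) y = inner x (adjoint T (T y))" for x y
      by (simp flip: adjoint_hilbert[OF T])
    show "0 \<le> inner (adjoint T (T x)) x" for x
      by (simp add: eq)
  qed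
  show "psd (\<lambda>x. adjoint B (B x))"
    by (rule *[OF B])
  show "psd (\<lambda>y. B (adjoint B y))"
    using *[OF bounded_linear_adjoint[OF B]] by (simp add: adjoint_adjoint_hilbert[OF B])
qed

lemma sum_funpow_telescope:
  fixes D :: "'a::real_vector \<Rightarrow> 'a"
  assumes "linear D"
  shows "(\<Sum>k<n. (D ^^ k) (x - D x)) = x - (D ^^ n) x"
proof -
  have lin: "linear (D ^^ k)" for k
    by (rule power_cone_linear[OF assms power_cone.power])
  show ?thesis
    by (induction n) (simp_all add: linear_diff[OF lin] funpow_swap1)
qed

text \<open>Truncated Neumann series: \<open>t \<Sum>\<^bsub>k<n\<^esub> (1 - t B B\<^sup>*)\<^sup>k B\<close> approximates a left inverse of \<open>B\<^sup>*\<close> on its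
  range, and the majorisation makes its composition with \<open>C\<^sup>*\<close> converge although the inverse is
  unbounded in general.\<close>

lemma majorisation_limit:
  fixes B :: "'b::{real_inner,complete_space} \<Rightarrow> 'c::{real_inner,complete_space}"
    and C :: "'a::{real_inner,complete_space} \<Rightarrow> 'c"
  assumes B: "bounded_linear B" and C: "bounded_linear C"
    and le: "\<And>y. norm (adjoint C y) \<le> norm (adjoint B y)"
  obtains t W where "bounded_linear W" and "\<And>y. W (adjoint B y) = adjoint C y"
    and "\<And>x. (\<lambda>n. adjoint C (\<Sum>k<n. ((\<lambda>y. y - t *\<^sub>R B (adjoint B y)) ^^ k) (t *\<^sub>R B x))) \<longlonglongrightarrow> W x"
proof -
  note B' = bounded_linear_adjoint[OF B] and C' = bounded_linear_adjoint[OF C]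
  note lB = bounded_linear.linear[OF B] and lB' = bounded_linear.linear[OF B']
    and lC' = bounded_linear.linear[OF C']
  obtain K1 where K1: "0 < K1" "\<And>x. norm (B x) \<le> norm x * K1"
    using bounded_linear.pos_bounded[OF B] by blast
  obtain K2 where K2: "0 < K2" "\<And>x. norm (adjoint B x) \<le> norm x * K2"
    using bounded_linear.pos_bounded[OF B'] by blast
  \<comment> \<open>This scale makes both \<open>t B B\<^sup>*\<close> and
    \<open>t B\<^sup>* B\<close> positive contractions.\<close>
  define t where "t = 1 / (K1 * K2)"
  have t: "0 < t" using K1 K2 by (simp add: t_def)
  define S where "S = (\<lambda>y. t *\<^sub>R B (adjoint B y))"
  define U where "U = (\<lambda>x. t *\<^sub>R adjoint B (B x))"
  have S: "positive_contraction S"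
    unfolding S_def t_def
  proof (rule positive_contraction_scaled[OF psd_self_adjoint_product(2)[OF B]])
    show "norm (B (adjoint B x)) \<le> norm x * (K1 * K2)" for x
      using order.trans[OF K1(2)[of "adjoint B x"] mult_right_mono[OF K2(2)[of x]]] K1(1)
      by (simp add: mult_ac)
  qed (use K1 K2 in simp)
  have U: "positive_contraction U"
    unfolding U_def t_def
  proof (rule positive_contraction_scaled[OF psd_self_adjoint_product(1)[OF B]])
    show "norm (adjoint B (B x)) \<le> norm x * (K1 * K2)" for x
      using order.trans[OF K2(2)[of "B x"] mult_right_mono[OF K1(2)[of x]]] K2(1)
      by (simp add: mult_ac)
  qed (use K1 K2 in simp)
  define D where "D = (\<lambda>y. y - S y)"
  define E where "E = (\<lambda>x. x - U x)"
  have D: "positive_contraction D" and E: "positive_contraction E"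
    unfolding D_def E_def by (rule positive_contraction_complement, fact)+
  note lD = positive_contraction_linear[OF D] and lE = positive_contraction_linear[OF E]
  define w where "w n v = (\<Sum>k<n. (D ^^ k) (t *\<^sub>R v))" for n v
  \<comment> \<open>\<open>w n\<close> is an approximate inverse of \<open>B B\<^sup>*\<close>: the
    geometric sum telescopes.\<close>
  have w_BB: "w n (B (adjoint B y)) = y - (D ^^ n) y" for n y
    using sum_funpow_telescope[OF lD, where n = n and x = y] by (simp add: w_def D_def S_def)
  have intertwine: "adjoint B ((D ^^ k) y) = (E ^^ k) (adjoint B y)" for k y
    by (induction k)
      (simp_all add: D_def E_def S_def U_def linear_diff[OF lB'] linear_scale[OF lB'] linear_scale[OF lB]
        linear_diff[OF lB])
  \<comment> \<open>The same telescoping on the other side, after moving \<open>B\<^sup>*\<close>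
    through the powers of \<open>D\<close>.\<close>
  have B'_w: "adjoint B (w n (B x)) = x - (E ^^ n) x" for n x
    using sum_funpow_telescope[OF lE, where n = n and x = x]
    by (simp add: w_def linear_sum[OF lB'] intertwine linear_scale[OF lB'] E_def U_def)
  define R where "R n x = adjoint C (w n (B x))" for n x
  have Cauchy: "Cauchy (\<lambda>n. R n x)" for x
  proof (rule metric_CauchyI)
    fix e :: real
    assume e: "0 < e"
    obtain Q where "(\<lambda>n. (E ^^ n) x) \<longlonglongrightarrow> Q x"
      using kernel_projection[OF U] unfolding E_def by metis
    then have "Cauchy (\<lambda>n. (E ^^ n) x)"
      by (rule LIMSEQ_imp_Cauchy)
    then obtain M where M: "\<And>m n. m \<ge> M \<Longrightarrow> n \<ge> M \<Longrightarrow> dist ((E ^^ m) x) ((E ^^ n) x) < e"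
      using metric_CauchyD[OF _ e] by blast
    have "dist (R m x) (R n x) < e" if "m \<ge> M" "n \<ge> M" for m n
    proof -
      \<comment> \<open>Majorisation replaces \<open>C\<^sup>*\<close> by \<open>B\<^sup>*\<close>,
        after which only the convergent powers of \<open>E\<close> remain.\<close>
      have "dist (R m x) (R n x) = norm (adjoint C (w m (B x) - w n (B x)))"
        by (simp add: R_def dist_norm linear_diff[OF lC'])
      also have "\<dots> \<le> norm (adjoint B (w m (B x) - w n (B x)))"
        by (rule le)
      also have "\<dots> = dist ((E ^^ m) x) ((E ^^ n) x)"
        by (simp add: linear_diff[OF lB'] B'_w dist_norm norm_minus_commute)
      finally show ?thesis
        using M[OF that] by simp
    qed
    then show "\<exists>M. \<forall>m\<ge>M. \<forall>n\<ge>M. dist (R m x) (R n x) < e"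
      by blast
  qed
  define W where "W x = lim (\<lambda>n. R n x)" for x
  have lim: "(\<lambda>n. R n x) \<longlonglongrightarrow> W x" for x
    unfolding W_def using Cauchy_convergent[OF Cauchy] by (simp add: convergent_LIMSEQ_iff)
  have "bounded_linear W"
  proof (rule bounded_linear_pointwise_limit[OF _ _ lim])
    fix n
    have "bounded_linear (\<lambda>x. (D ^^ k) (t *\<^sub>R B x))" for k
      using bounded_linear_funpow[OF psd_bounded_linear[OF positive_contraction_psd[OF D]]]
      by (rule bounded_linear_compose[OF _ bounded_linear_compose[OF bounded_linear_scaleR_right B]])
    then show "bounded_linear (R n)"
      unfolding R_def w_def by (intro bounded_linear_compose[OF C'] bounded_linear_sum)
    fix x
    have "norm ((E ^^ n) x) \<le> norm x"
      by (induction n) (auto intro: order.trans positive_contraction_norm[OF E])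
    then have "norm (x - (E ^^ n) x) \<le> norm x * 2"
      using norm_triangle_ineq4[of x "(E ^^ n) x"] by simp
    then show "norm (R n x) \<le> norm x * 2"
      using le[of "w n (B x)"] by (simp add: R_def B'_w)
  qed
  moreover have "W (adjoint B y) = adjoint C y" for y
  proof -
    obtain P where P: "\<And>y. (\<lambda>n. (D ^^ n) y) \<longlonglongrightarrow> P y" "\<And>y. S (P y) = 0"
      using kernel_projection[OF S] unfolding D_def by metis
    \<comment> \<open>The limit of the remainders \<open>(D ^^ n) y\<close> lies in the kernel of
      \<open>B\<^sup>*\<close>; majorisation makes \<open>C\<^sup>*\<close> vanish there
      too.\<close>
    have "B (adjoint B (P y)) = 0"
      using P(2)[of y] t by (simp add: S_def)
    then have "inner (adjoint B (P y)) (adjoint B (P y)) = 0"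
      using adjoint_hilbert[OF B, of "adjoint B (P y)" "P y"] by simp
    then have "adjoint C (P y) = 0"
      using le[of "P y"] by simp
    moreover have "(\<lambda>n. R n (adjoint B y)) \<longlonglongrightarrow> adjoint C (y - P y)"
      unfolding R_def w_BB by (intro bounded_linear.tendsto[OF C'] tendsto_intros P)
    ultimately show ?thesis
      using LIMSEQ_unique[OF lim] by (simp add: linear_diff[OF lC'])
  qed
  ultimately show thesis
    using lim unfolding R_def w_def D_def S_def by (rule that)
qed

lemma adjoint_factor:
  fixes B :: "'b::{real_inner,complete_space} \<Rightarrow> 'c::{real_inner,complete_space}"
    and C :: "'a::{real_inner,complete_space} \<Rightarrow> 'c"
  assumes B: "bounded_linear B" and C: "bounded_linear C" and W: "bounded_linear W"
    and fac: "\<And>y. W (adjoint B y) = adjoint C y"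
  shows "C x = B (adjoint W x)"
proof (rule vector_eq_rdot[THEN iffD1], rule allI)
  fix y
  have "inner (B (adjoint W x)) y = inner (adjoint W x) (adjoint B y)"
    by (rule adjoint_hilbert[OF B])
  also have "\<dots> = inner x (W (adjoint B y))"
    by (rule adjoint_hilbert_left[OF W])
  also have "\<dots> = inner (C x) y"
    by (simp add: fac adjoint_hilbert[OF C])
  finally show "inner (C x) y = inner (B (adjoint W x)) y" ..
qed

text \<open>Adjoining \<open>W B\<^sup>* = C\<^sup>*\<close> gives \<open>C = B W\<^sup>*\<close>.
  The domains of \<open>B\<close> and \<open>C\<close> may differ, so operators on the space and on
  its double can be compared.\<close>

lemma majorisation_range:
  fixes B :: "'b::{real_inner,complete_space} \<Rightarrow> 'c::{real_inner,complete_space}"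
    and C :: "'a::{real_inner,complete_space} \<Rightarrow> 'c"
  assumes "bounded_linear B" and "bounded_linear C"
    and "\<And>y. norm (adjoint C y) \<le> norm (adjoint B y)"
  shows "range C \<subseteq> range B"
proof -
  obtain W where "bounded_linear W" "\<And>y. W (adjoint B y) = adjoint C y"
    using majorisation_limit[OF assms] by metis
  then show ?thesis
    using adjoint_factor[OF assms(1,2)] by blast
qed

text \<open>All operators now act on one space, so the truncated series are polynomials in
  \<open>B\<close>, \<open>adjoint B\<close> and \<open>adjoint C\<close>; their limit
  \<open>W\<close> stays in \<open>N\<close>, and the factor is \<open>adjoint W\<close>.\<close>

lemma majorisation_factor:
  fixes B C :: "'a::{real_inner,complete_space} \<Rightarrow> 'a"
  assumes N: "sot_closed_algebra N" and bl: "\<And>T. T \<in> N \<Longrightarrow> bounded_linear T"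
    and adj: "\<And>T. T \<in> N \<Longrightarrow> adjoint T \<in> N"
    and B: "B \<in> N" and C: "C \<in> N" and le: "\<And>y. norm (adjoint C y) \<le> norm (adjoint B y)"
  obtains Z where "Z \<in> N" and "\<And>x. C x = B (Z x)"
proof -
  obtain t W where W: "bounded_linear W" "\<And>y. W (adjoint B y) = adjoint C y"
    and lim: "\<And>x. (\<lambda>n. adjoint C (\<Sum>k<n. ((\<lambda>y. y - t *\<^sub>R B (adjoint B y)) ^^ k) (t *\<^sub>R B x))) \<longlonglongrightarrow> W x"
    using majorisation_limit[OF bl[OF B] bl[OF C] le] by metis
  let ?D = "\<lambda>y. y - t *\<^sub>R B (adjoint B y)"
  have "W \<in> N"
  proof (rule sot_limit[OF N _ lim W(1)])
    fix n
    have "(\<lambda>y. t *\<^sub>R B (adjoint B y)) \<in> N"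
      using sot_scale[OF N sot_comp[OF N B adj[OF B]]] by simp
    then have D: "?D \<in> N"
      by (rule sot_complement[OF N])
    have "(\<lambda>x. \<Sum>k<n. ((?D ^^ k) \<circ> (\<lambda>x. t *\<^sub>R B x)) x) \<in> N"
      by (rule sot_sum[OF N sot_comp[OF N sot_power[OF N D] sot_scale[OF N B]]])
    from sot_comp[OF N adj[OF C] this]
    show "(\<lambda>x. adjoint C (\<Sum>k<n. (?D ^^ k) (t *\<^sub>R B x))) \<in> N"
      by (simp add: o_def)
  qed
  then show thesis
    using adjoint_factor[OF bl[OF B] bl[OF C] W] that adj by blast
qed

section \<open>Complex Hilbert spaces\<close>

lemma cinner_scaleC_right: "cinner x (c *\<^sub>C y) = cnj c * cinner x y"
  by (metis cinner_commute cinner_scaleC_left complex_cnj_mult)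

lemma Im_cinner: "Im (cinner x y) = inner x (\<i> *\<^sub>C y)"
  by (simp add: cinner_scaleC_right flip: Re_cinner)

lemma Im_cinner': "Im (cinner x y) = - inner (\<i> *\<^sub>C x) y"
  by (simp add: cinner_scaleC_left flip: Re_cinner)

lemma norm_scaleC: "norm (c *\<^sub>C x) = cmod c * norm x"
proof (rule power2_eq_imp_eq)
  have "Im (cinner x x) = 0"
    using arg_cong[OF cinner_commute[of x x], of Im] by simp
  moreover have "cinner (c *\<^sub>C x) (c *\<^sub>C x) = complex_of_real ((cmod c)\<^sup>2) * cinner x x"
    unfolding complex_norm_square by (simp add: cinner_scaleC_left cinner_scaleC_right)
  ultimately show "(norm (c *\<^sub>C x))\<^sup>2 = (cmod c * norm x)\<^sup>2"
    by (simp add: power2_norm_eq_inner power_mult_distrib flip: Re_cinner)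
qed simp_all

lemma bounded_linear_scaleC: "bounded_linear (\<lambda>x::'a::complex_hilbert. c *\<^sub>C x)"
proof (rule bounded_linear_intro)
  show "c *\<^sub>C (r *\<^sub>R x) = r *\<^sub>R (c *\<^sub>C x)" for r and x :: 'a
    by (simp add: scaleC_scaleC mult.commute flip: scaleC_of_real)
  show "norm (c *\<^sub>C x) \<le> norm x * cmod c" for x :: 'a
    by (simp add: norm_scaleC)
qed (rule scaleC_add_right)

lemma scaleC_one: "1 *\<^sub>C x = x"
  using scaleC_of_real[of 1 x] by simp

lemma scaleC_zero: "c *\<^sub>C (0::'a::complex_hilbert) = 0"
  by (rule linear_0[OF bounded_linear.linear[OF bounded_linear_scaleC]])

lemma bounded_clinear_linear: "bounded_clinear T \<Longrightarrow> bounded_linear T"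
  by (simp add: bounded_clinear_def)

lemma bounded_clinear_scaleC: "bounded_clinear T \<Longrightarrow> T (c *\<^sub>C x) = c *\<^sub>C T x"
  by (simp add: bounded_clinear_def)

lemma cinner_eqI:
  assumes "\<And>x. cinner x y = cinner x z"
  shows "y = z"
  by (rule vector_eq_ldot[THEN iffD1]) (simp add: assms flip: Re_cinner)

text \<open>The real adjoint is also the complex one: the imaginary part of the identity is the real
  identity at \<open>\<i> *\<^sub>C x\<close>.\<close>

lemma cinner_adjoint:
  assumes "bounded_clinear T"
  shows "cinner (T x) y = cinner x (adjoint T y)"
proof (rule complex_eqI)
  note adj = adjoint_hilbert[OF bounded_clinear_linear[OF assms]]
  show "Re (cinner (T x) y) = Re (cinner x (adjoint T y))"
    by (simp add: Re_cinner adj)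
  show "Im (cinner (T x) y) = Im (cinner x (adjoint T y))"
    by (simp add: Im_cinner' flip: adj bounded_clinear_scaleC[OF assms])
qed

lemma cadjoint_eq_adjoint:
  assumes "bounded_clinear T"
  shows "cadjoint T = adjoint T"
  unfolding cadjoint_def
proof (rule the_equality)
  show "\<forall>x y. cinner (T x) y = cinner x (adjoint T y)"
    by (simp add: cinner_adjoint[OF assms])
  show "S = adjoint T" if "\<forall>x y. cinner (T x) y = cinner x (S y)" for S
  proof
    show "S y = adjoint T y" for y
      by (rule cinner_eqI) (simp add: that[rule_format, symmetric] cinner_adjoint[OF assms])
  qed
qed

text \<open>Over the complex numbers a real quadratic form forces symmetry, by polarisation.\<close>

lemma psd_if_positive_op:
  assumes "positive_op T"
  shows "psd T"
  unfolding psd_def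
proof (intro conjI allI)
  have T: "bounded_clinear T" and pos: "\<And>x. cinner (T x) x \<in> \<real>\<^sub>\<ge>\<^sub>0"
    using assms by (auto simp: positive_op_def)
  note lin = bounded_linear.linear[OF bounded_clinear_linear[OF T]]
  show "bounded_linear T"
    by (rule bounded_clinear_linear[OF T])
  show "0 \<le> inner (T x) x" for x
    using pos[of x] by (simp add: complex_nonneg_Reals_iff Re_cinner)
  \<comment> \<open>Reality of the form at \<open>x + y\<close>, \<open>x\<close> and
    \<open>y\<close> leaves opposite imaginary parts for the two cross terms; the symmetry claim
    then follows with \<open>- \<i> *\<^sub>C x\<close> in place of \<open>x\<close>.\<close>
  have key: "inner (T y) (\<i> *\<^sub>C x) = inner (T (\<i> *\<^sub>C x)) y" for x y
  proof -
    have Im0: "Im (cinner (T z) z) = 0" for z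
      using pos[of z] by (simp add: complex_nonneg_Reals_iff)
    have "Im (cinner (T x) y) + Im (cinner (T y) x) = 0"
      using Im0[of "x + y"] Im0[of x] Im0[of y]
      by (simp add: Im_cinner linear_add[OF lin] scaleC_add_right inner_add_left inner_add_right)
    then show ?thesis
      unfolding Im_cinner[of "T y" x] Im_cinner'[of "T x" y]
      by (simp add: bounded_clinear_scaleC[OF T])
  qed
  show "inner (T x) y = inner x (T y)" for x y
    using key[of y "- \<i> *\<^sub>C x"] by (simp add: scaleC_scaleC scaleC_one inner_commute)
qed

text \<open>Symmetry makes the imaginary part of the quadratic form equal to its own
  negative.\<close>

lemma positive_op_if_psd:
  assumes T: "bounded_clinear T" and psd: "psd T"
  shows "positive_op T"
  unfolding positive_op_def
proof (intro conjI allI T)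
  fix x
  have "Im (cinner (T x) x) = - inner (T (\<i> *\<^sub>C x)) x"
    by (simp add: Im_cinner' bounded_clinear_scaleC[OF T])
  also have "\<dots> = - inner (\<i> *\<^sub>C x) (T x)"
    by (simp add: psd_sym[OF psd])
  also have "\<dots> = - Im (cinner (T x) x)"
    by (simp add: Im_cinner inner_commute)
  finally show "cinner (T x) x \<in> \<real>\<^sub>\<ge>\<^sub>0"
    using psd_nonneg[OF psd, of x] by (simp add: complex_nonneg_Reals_iff Re_cinner)
qed

section \<open>Closure properties of bounded complex linear maps\<close>

lemma bounded_clinear_add:
  "bounded_clinear S \<Longrightarrow> bounded_clinear T \<Longrightarrow> bounded_clinear (\<lambda>x. S x + T x)"
  by (simp add: bounded_clinear_def bounded_linear_add scaleC_add_right)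

lemma bounded_clinear_scaleR:
  assumes "bounded_clinear T"
  shows "bounded_clinear (\<lambda>x. r *\<^sub>R T x)"
  unfolding bounded_clinear_def
proof (intro conjI allI)
  show "bounded_linear (\<lambda>x. r *\<^sub>R T x)"
    by (rule bounded_linear_compose[OF bounded_linear_scaleR_right bounded_clinear_linear[OF assms]])
  show "r *\<^sub>R T (c *\<^sub>C x) = c *\<^sub>C r *\<^sub>R T x" for c x
    by (simp add: bounded_clinear_scaleC[OF assms] scaleC_scaleC mult.commute flip: scaleC_of_real)
qed

lemma bounded_clinear_comp: "bounded_clinear S \<Longrightarrow> bounded_clinear T \<Longrightarrow> bounded_clinear (S \<circ> T)"
  by (simp add: bounded_clinear_def bounded_linear_compose o_def)

lemma bounded_clinear_limit:
  fixes F :: "nat \<Rightarrow> 'a::complex_hilbert \<Rightarrow> 'a"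
  assumes F: "\<And>n. bounded_clinear (F n)" and lim: "\<And>x. (\<lambda>n. F n x) \<longlonglongrightarrow> T x"
    and T: "bounded_linear T"
  shows "bounded_clinear T"
  unfolding bounded_clinear_def
proof (intro conjI allI T)
  fix c x
  show "T (c *\<^sub>C x) = c *\<^sub>C T x"
  proof (rule LIMSEQ_unique[OF lim])
    show "(\<lambda>n. F n (c *\<^sub>C x)) \<longlonglongrightarrow> c *\<^sub>C T x"
      unfolding bounded_clinear_scaleC[OF F]
      by (rule bounded_linear.tendsto[OF bounded_linear_scaleC lim])
  qed
qed

lemma sot_closed_algebra_bounded_clinear:
  "sot_closed_algebra (Collect (bounded_clinear :: ('a::complex_hilbert \<Rightarrow> 'a) \<Rightarrow> bool))"
  unfolding sot_closed_algebra_def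
proof (intro conjI ballI allI impI)
  fix F and T :: "'a \<Rightarrow> 'a"
  assume F: "(\<forall>n::nat. F n \<in> Collect bounded_clinear) \<and> (\<forall>x. (\<lambda>n. F n x) \<longlonglongrightarrow> T x) \<and> bounded_linear T"
  show "T \<in> Collect bounded_clinear"
    using bounded_clinear_limit[of F T] F by simp
qed (simp_all add: bounded_clinear_add bounded_clinear_scaleR bounded_clinear_comp,
    simp add: bounded_clinear_def id_def)

text \<open>The real theory suffices: a complex positive root is \<open>psd\<close>, hence unique,
  and the root constructed over the reals is complex linear.\<close>

lemma sqrt_op_psd:
  fixes S :: "'a::complex_hilbert \<Rightarrow> 'a"
  assumes S: "bounded_clinear S" and psd: "psd S"
  shows "psd (sqrt_op S)" and "sqrt_op S (sqrt_op S x) = S x"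
    and "sot_closed_algebra N \<Longrightarrow> S \<in> N \<Longrightarrow> sqrt_op S \<in> N"
proof -
  obtain Z where Z: "psd Z" "\<And>x. Z (Z x) = S x"
    and ZN: "\<And>N. sot_closed_algebra N \<Longrightarrow> S \<in> N \<Longrightarrow> Z \<in> N"
    using psd_sqrt[OF psd] by metis
  \<comment> \<open>Complex linearity is obtained as membership in a strongly closed algebra
    containing \<open>S\<close>.\<close>
  have "bounded_clinear Z"
    using ZN[OF sot_closed_algebra_bounded_clinear] S by simp
  then have pos: "positive_op Z"
    by (rule positive_op_if_psd[OF _ Z(1)])
  have "sqrt_op S = Z"
    unfolding sqrt_op_def
  proof (rule the_equality)
    show "positive_op Z \<and> Z \<circ> Z = S"
      using pos Z(2) by (auto simp: fun_eq_iff)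
    show "R = Z" if R: "positive_op R \<and> R \<circ> R = S" for R
    proof (rule psd_sqrt_unique[OF _ Z(1)])
      show "psd R"
        using R psd_if_positive_op by blast
      show "R (R x) = Z (Z x)" for x
        using R Z(2) by (auto simp: fun_eq_iff)
    qed
  qed
  then show "psd (sqrt_op S)" and "sqrt_op S (sqrt_op S x) = S x"
    and "sot_closed_algebra N \<Longrightarrow> S \<in> N \<Longrightarrow> sqrt_op S \<in> N"
    using Z ZN by auto
qed

text \<open>\<open>T\<close> and \<open>T\<^sup>* T\<close> have the same kernel, so the kernel
  projection of a scaled \<open>T\<^sup>* T\<close> is the orthogonal projection onto
  \<open>null T\<close>, and a limit of polynomials in \<open>T\<^sup>* T\<close>.\<close>

lemma null_proj:
  fixes T :: "'a::complex_hilbert \<Rightarrow> 'b::complex_hilbert"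
  assumes T: "bounded_clinear T"
  shows "positive_contraction (null_proj T)"
    and "T (null_proj T x) = 0"
    and "T x = 0 \<Longrightarrow> null_proj T x = x"
    and "sot_closed_algebra N \<Longrightarrow> (\<lambda>x. adjoint T (T x)) \<in> N \<Longrightarrow> null_proj T \<in> N"
proof -
  note Tb = bounded_clinear_linear[OF T]
  note lin = bounded_linear.linear[OF Tb]
  have psd: "psd (\<lambda>x. adjoint T (T x))"
    by (rule psd_self_adjoint_product(1)[OF Tb])
  obtain K where K: "0 < K" "\<And>x. norm (adjoint T (T x)) \<le> norm x * K"
    using bounded_linear.pos_bounded[OF psd_bounded_linear[OF psd]] by blast
  define S where "S = (\<lambda>x. (1/K) *\<^sub>R adjoint T (T x))"
  have S: "positive_contraction S"
    unfolding S_def by (rule positive_contraction_scaled[OF psd K(2,1)])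
  have zero: "S x = 0 \<longleftrightarrow> T x = 0" for x
  proof
    assume "S x = 0"
    then have "inner (T x) (T x) = 0"
      using K(1) adjoint_hilbert[OF Tb, of x "T x"] by (simp add: S_def)
    then show "T x = 0" by simp
  qed (simp add: S_def linear_0 bounded_linear.linear[OF bounded_linear_adjoint[OF Tb]])
  obtain P where P: "positive_contraction P"
    and lim: "\<And>x. (\<lambda>n. ((\<lambda>x. x - S x) ^^ n) x) \<longlonglongrightarrow> P x"
    and P0: "\<And>x. S (P x) = 0" and P1: "\<And>x. S x = 0 \<Longrightarrow> P x = x"
    using kernel_projection[OF S] by metis
  note TP = P0[unfolded zero] and PT = P1[unfolded zero]
  have eq: "null_proj T = P"
  proof
    fix x
    have orth: "inner (x - P x) v = 0" if "T v = 0" for v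
      using PT[OF that] psd_sym[OF positive_contraction_psd[OF P], of x v] by (simp add: inner_diff_left)
    show "null_proj T x = P x"
      unfolding null_proj_def orth_proj_def null_def
    proof (rule the_equality)
      \<comment> \<open>The kernel is complex, so real orthogonality to
        \<open>\<i> *\<^sub>C v\<close> gives the imaginary part.\<close>
      have "cinner (x - P x) v = 0" if "T v = 0" for v
        using orth[OF that] orth[of "\<i> *\<^sub>C v"] that
        by (intro complex_eqI) (simp_all add: Re_cinner Im_cinner bounded_clinear_scaleC[OF T] scaleC_zero)
      then show "P x \<in> {x. T x = 0} \<and> (\<forall>v\<in>{x. T x = 0}. cinner (x - P x) v = 0)"
        using TP by simp
      fix u
      assume u: "u \<in> {x. T x = 0} \<and> (\<forall>v\<in>{x. T x = 0}. cinner (x - u) v = 0)"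
      have d: "T (P x - u) = 0"
        using u TP by (simp add: linear_diff[OF lin])
      have "inner (P x - u) (P x - u) = inner (x - u) (P x - u) - inner (x - P x) (P x - u)"
        by (simp add: inner_diff_left)
      also have "\<dots> = 0"
        using u d orth[OF d] by (simp flip: Re_cinner)
      finally show "u = P x" by simp
    qed
  qed
  show "positive_contraction (null_proj T)" "T (null_proj T x) = 0" "T x = 0 \<Longrightarrow> null_proj T x = x"
    unfolding eq using P TP PT by auto
  show "null_proj T \<in> N" if N: "sot_closed_algebra N" and TT: "(\<lambda>x. adjoint T (T x)) \<in> N"
    unfolding eq
  proof (rule sot_limit[OF N _ lim psd_bounded_linear[OF positive_contraction_psd[OF P]]])
    show "((\<lambda>x. x - S x) ^^ n) \<in> N" for n
      unfolding S_def by (intro sot_power sot_complement sot_scale N TT)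
  qed
qed

section \<open>Von Neumann algebras\<close>

context
  fixes M :: "('h::complex_hilbert \<Rightarrow> 'h) set"
  assumes M: "von_neumann_algebra M"
begin

lemma vN_bounded_clinear: "T \<in> M \<Longrightarrow> bounded_clinear T"
  using M unfolding von_neumann_algebra_def by blast

lemma vN_bounded_linear: "T \<in> M \<Longrightarrow> bounded_linear T"
  by (rule bounded_clinear_linear[OF vN_bounded_clinear])

lemma vN_adjoint: "T \<in> M \<Longrightarrow> adjoint T \<in> M"
  using M cadjoint_eq_adjoint[OF vN_bounded_clinear, of T] unfolding von_neumann_algebra_def by metis

lemma sot_closed_algebra_vN: "sot_closed_algebra M"
  unfolding sot_closed_algebra_def
proof (intro conjI ballI allI impI)
  show "id \<in> M"
    using M unfolding von_neumann_algebra_def by blast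
  fix S T
  assume "S \<in> M" "T \<in> M"
  then show "(\<lambda>x. S x + T x) \<in> M" "S \<circ> T \<in> M"
    using M unfolding von_neumann_algebra_def by blast+
next
  fix r :: real and T
  assume "T \<in> M"
  then have "(\<lambda>x. complex_of_real r *\<^sub>C T x) \<in> M"
    using M unfolding von_neumann_algebra_def by blast
  then show "(\<lambda>x. r *\<^sub>R T x) \<in> M"
    by (simp add: scaleC_of_real)
next
  fix F and T :: "'h \<Rightarrow> 'h"
  assume F: "(\<forall>n::nat. F n \<in> M) \<and> (\<forall>x. (\<lambda>n. F n x) \<longlonglongrightarrow> T x) \<and> bounded_linear T"
  obtain V where V: "closed V" "M = Collect bounded_clinear \<inter> V"
    using M unfolding von_neumann_algebra_def closedin_closed by blast
  \<comment> \<open>Pointwise convergence is convergence in the product topology of the function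
    type, where \<open>V\<close> is closed.\<close>
  have "limitin (product_topology (\<lambda>_. euclidean) UNIV) F T sequentially"
    using F by (simp add: limitin_componentwise)
  then have "F \<longlonglongrightarrow> T"
    by (simp add: euclidean_product_topology)
  moreover have "\<And>n. F n \<in> V"
    using F V(2) by blast
  ultimately have "T \<in> V"
    using V(1) closed_sequentially by blast
  moreover have "bounded_clinear T"
    using bounded_clinear_limit[of F T] F vN_bounded_clinear by simp
  ultimately show "T \<in> M"
    by (simp add: V(2))
qed

lemma vN_majorisation_factor:
  assumes "B \<in> M" and "C \<in> M" and "\<And>y. norm (adjoint C y) \<le> norm (adjoint B y)"
  obtains Z where "Z \<in> M" and "\<And>x. C x = B (Z x)"
  by (rule majorisation_factor[OF sot_closed_algebra_vN _ _ assms])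
    (auto intro: vN_bounded_linear vN_adjoint)

end

text \<open>The algebra of 2 by 2 matrices over \<open>M\<close>, used to place the null projection
  of \<open>T_block\<close> and hence its corner entry.\<close>

definition matrix_algebra :: "('h::complex_hilbert \<Rightarrow> 'h) set \<Rightarrow> ('h \<times> 'h \<Rightarrow> 'h \<times> 'h) set" where
  "matrix_algebra M = {block_op a b c d | a b c d. a \<in> M \<and> b \<in> M \<and> c \<in> M \<and> d \<in> M}"

lemma matrix_algebraI:
  assumes "bounded_linear F"
    and "(\<lambda>x. fst (F (x, 0))) \<in> M" "(\<lambda>y. fst (F (0, y))) \<in> M"
    and "(\<lambda>x. snd (F (x, 0))) \<in> M" "(\<lambda>y. snd (F (0, y))) \<in> M"
  shows "F \<in> matrix_algebra M"
proof -
  have "F p = block_op (\<lambda>x. fst (F (x, 0))) (\<lambda>y. fst (F (0, y)))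
      (\<lambda>x. snd (F (x, 0))) (\<lambda>y. snd (F (0, y))) p" for p
    using linear_add[OF bounded_linear.linear[OF assms(1)], of "(fst p, 0)" "(0, snd p)"]
    by (simp add: block_op_def case_prod_beta prod_eq_iff)
  then have "F = block_op (\<lambda>x. fst (F (x, 0))) (\<lambda>y. fst (F (0, y)))
      (\<lambda>x. snd (F (x, 0))) (\<lambda>y. snd (F (0, y)))" ..
  then show ?thesis
    using assms(2-) unfolding matrix_algebra_def by blast
qed

lemma matrix_algebra_entries:
  assumes F: "F \<in> matrix_algebra M" and bl: "\<And>T. T \<in> M \<Longrightarrow> bounded_linear T"
  shows "(\<lambda>x. fst (F (x, 0))) \<in> M" "(\<lambda>y. fst (F (0, y))) \<in> M"
    "(\<lambda>x. snd (F (x, 0))) \<in> M" "(\<lambda>y. snd (F (0, y))) \<in> M"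
proof -
  obtain a b c d where "F = block_op a b c d" "a \<in> M" "b \<in> M" "c \<in> M" "d \<in> M"
    using F unfolding matrix_algebra_def by blast
  then show "(\<lambda>x. fst (F (x, 0))) \<in> M" "(\<lambda>y. fst (F (0, y))) \<in> M"
    "(\<lambda>x. snd (F (x, 0))) \<in> M" "(\<lambda>y. snd (F (0, y))) \<in> M"
    by (simp_all add: block_op_def linear_0 bounded_linear.linear bl)
qed

text \<open>Products follow matrix multiplication, and a pointwise limit on the doubled space is a
  pointwise limit of each entry.\<close>

lemma sot_closed_algebra_matrix:
  assumes M: "sot_closed_algebra M" and bl: "\<And>T. T \<in> M \<Longrightarrow> bounded_linear T"
  shows "sot_closed_algebra (matrix_algebra M)"
  unfolding sot_closed_algebra_def
proof (intro conjI ballI allI impI)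
  show "id \<in> matrix_algebra M"
    by (rule matrix_algebraI)
      (use sot_id[OF M] sot_zero[OF M] in \<open>simp_all add: id_def\<close>)
  fix F G
  assume F: "F \<in> matrix_algebra M" and G: "G \<in> matrix_algebra M"
  obtain a b c d where F_eq: "F = block_op a b c d" "a \<in> M" "b \<in> M" "c \<in> M" "d \<in> M"
    using F unfolding matrix_algebra_def by blast
  obtain a' b' c' d' where G_eq: "G = block_op a' b' c' d'" "a' \<in> M" "b' \<in> M" "c' \<in> M" "d' \<in> M"
    using G unfolding matrix_algebra_def by blast
  have "(\<lambda>x. F x + G x) =
      block_op (\<lambda>x. a x + a' x) (\<lambda>x. b x + b' x) (\<lambda>x. c x + c' x) (\<lambda>x. d x + d' x)"
    by (auto simp: F_eq G_eq block_op_def)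
  then show "(\<lambda>x. F x + G x) \<in> matrix_algebra M"
    unfolding matrix_algebra_def using F_eq G_eq sot_add[OF M] by blast
  have "F \<circ> G = block_op (\<lambda>x. (a \<circ> a') x + (b \<circ> c') x) (\<lambda>x. (a \<circ> b') x + (b \<circ> d') x)
      (\<lambda>x. (c \<circ> a') x + (d \<circ> c') x) (\<lambda>x. (c \<circ> b') x + (d \<circ> d') x)"
    by (auto simp: F_eq(1) G_eq(1) block_op_def fun_eq_iff linear_add bounded_linear.linear bl F_eq(2-))
  moreover have "(\<lambda>x. (s \<circ> s') x + (t \<circ> t') x) \<in> M"
    if "s \<in> M" "s' \<in> M" "t \<in> M" "t' \<in> M" for s s' t t'
    using that by (intro sot_add[OF M] sot_comp[OF M])
  ultimately show "F \<circ> G \<in> matrix_algebra M"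
    unfolding matrix_algebra_def using F_eq G_eq by blast
next
  fix r :: real and F
  assume "F \<in> matrix_algebra M"
  then obtain a b c d where F_eq: "F = block_op a b c d" "a \<in> M" "b \<in> M" "c \<in> M" "d \<in> M"
    unfolding matrix_algebra_def by blast
  have "(\<lambda>x. r *\<^sub>R F x) =
      block_op (\<lambda>x. r *\<^sub>R a x) (\<lambda>x. r *\<^sub>R b x) (\<lambda>x. r *\<^sub>R c x) (\<lambda>x. r *\<^sub>R d x)"
    by (auto simp: F_eq block_op_def algebra_simps)
  then show "(\<lambda>x. r *\<^sub>R F x) \<in> matrix_algebra M"
    unfolding matrix_algebra_def using F_eq sot_scale[OF M] by blast
next
  fix F and T :: "'a \<times> 'a \<Rightarrow> 'a \<times> 'a"
  assume F: "(\<forall>n::nat. F n \<in> matrix_algebra M) \<and> (\<forall>x. (\<lambda>n. F n x) \<longlonglongrightarrow> T x) \<and> bounded_linear T"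
  have "F n \<in> matrix_algebra M" for n
    using F by blast
  note entries = matrix_algebra_entries[OF this bl]
  have T: "bounded_linear T" and lim: "\<And>x. (\<lambda>n. F n x) \<longlonglongrightarrow> T x"
    using F by auto
  have Tl: "bounded_linear (\<lambda>x. T (x, 0))" "bounded_linear (\<lambda>y. T (0, y))"
    by (rule bounded_linear_compose[OF T], intro bounded_linear_Pair bounded_linear_ident bounded_linear_zero)+
  show "T \<in> matrix_algebra M"
  proof (rule matrix_algebraI[OF T])
    show "(\<lambda>x. fst (T (x, 0))) \<in> M"
      by (rule sot_limit[OF M, where F = "\<lambda>n x. fst (F n (x, 0))"])
        (rule entries, assumption, rule tendsto_fst[OF lim], rule bounded_linear_compose[OF bounded_linear_fst Tl(1)])
    show "(\<lambda>y. fst (T (0, y))) \<in> M"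
      by (rule sot_limit[OF M, where F = "\<lambda>n y. fst (F n (0, y))"])
        (rule entries, assumption, rule tendsto_fst[OF lim], rule bounded_linear_compose[OF bounded_linear_fst Tl(2)])
    show "(\<lambda>x. snd (T (x, 0))) \<in> M"
      by (rule sot_limit[OF M, where F = "\<lambda>n x. snd (F n (x, 0))"])
        (rule entries, assumption, rule tendsto_snd[OF lim], rule bounded_linear_compose[OF bounded_linear_snd Tl(1)])
    show "(\<lambda>y. snd (T (0, y))) \<in> M"
      by (rule sot_limit[OF M, where F = "\<lambda>n y. snd (F n (0, y))"])
        (rule entries, assumption, rule tendsto_snd[OF lim], rule bounded_linear_compose[OF bounded_linear_snd Tl(2)])
  qed
qed

section \<open>The null projection of a row\<close>

lemma adjoint_psd: "psd T \<Longrightarrow> adjoint T = T"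
  by (rule adjoint_unique) (simp add: psd_def)

lemma psd_norm_sq:
  assumes "psd Z"
  shows "(norm (Z x))\<^sup>2 = inner (Z (Z x)) x"
  using psd_sym[OF assms, of "Z x" x] by (simp add: power2_norm_eq_inner)

lemma T_block_apply: "T_block A B p = (A (fst p) - B (snd p), 0)"
  by (simp add: T_block_def block_op_def case_prod_beta)

context
  fixes M :: "('h::complex_hilbert \<Rightarrow> 'h) set" and A B :: "'h \<Rightarrow> 'h" and P
  assumes M: "von_neumann_algebra M" and A: "A \<in> M" and B: "B \<in> M"
  defines "P \<equiv> null_proj (T_block A B)"
begin

private lemma linear_AB: "bounded_linear A" "bounded_linear B" "linear A" "linear B"
  using vN_bounded_linear[OF M] A B by (auto intro: bounded_linear.linear)

private lemma T_block_clinear: "bounded_clinear (T_block A B)"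
  unfolding bounded_clinear_def
proof (intro conjI allI)
  have "bounded_linear (\<lambda>p. (A (fst p) - B (snd p), 0::'h))"
    by (intro bounded_linear_Pair bounded_linear_sub bounded_linear_zero
        bounded_linear_compose[OF linear_AB(1)] bounded_linear_compose[OF linear_AB(2)]
        bounded_linear_fst bounded_linear_snd)
  then show "bounded_linear (T_block A B)"
    by (simp add: T_block_apply[abs_def])
  show "T_block A B (c *\<^sub>C p) = c *\<^sub>C T_block A B p" for c p
    by (simp add: T_block_apply scaleC_prod_def scaleC_zero
        bounded_clinear_scaleC vN_bounded_clinear[OF M] A B
        linear_diff[OF bounded_linear.linear[OF bounded_linear_scaleC]])
qed

private lemma adjoint_T_block: "adjoint (T_block A B) = (\<lambda>q. (adjoint A (fst q), - adjoint B (fst q)))"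
  by (rule adjoint_unique)
    (simp add: T_block_apply inner_prod_def inner_diff_left adjoint_hilbert linear_AB)

lemma P_contraction: "positive_contraction P"
  unfolding P_def by (rule null_proj(1)[OF T_block_clinear])

lemma P_null: "A (fst (P p)) = B (snd (P p))"
  using null_proj(2)[OF T_block_clinear, of p] by (simp add: P_def T_block_apply prod_eq_iff)

lemma P_fixes: "A x = B y \<Longrightarrow> P (x, y) = (x, y)"
  using null_proj(3)[OF T_block_clinear, of "(x, y)"] by (simp add: P_def T_block_apply prod_eq_iff)

lemma P_idem: "P (P p) = P p"
  using P_fixes[OF P_null, of p] by simp

lemma P_norm_sq: "(norm (P p))\<^sup>2 = inner (P p) p"
  using psd_sym[OF positive_contraction_psd[OF P_contraction], of "P p" p]
  by (simp add: P_idem power2_norm_eq_inner)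

text \<open>\<open>P\<close> vanishes on the range of the adjoint of \<open>T_block A B\<close>, which contains
  \<open>(A\<^sup>* y, - B\<^sup>* y)\<close>.\<close>

lemma P_adjoint: "P (adjoint A y, 0) = P (0, adjoint B y)"
proof -
  let ?q = "(adjoint A y, - adjoint B y)"
  have "inner (P ?q) v = 0" for v
  proof -
    have "inner (P ?q) v = inner ?q (P v)"
      by (rule psd_sym[OF positive_contraction_psd[OF P_contraction]])
    also have "\<dots> = inner y (A (fst (P v))) - inner y (B (snd (P v)))"
      by (simp add: inner_prod_def adjoint_hilbert_left linear_AB)
    finally show ?thesis
      by (simp add: P_null)
  qed
  from this[of "P ?q"] have "P ((adjoint A y, 0) - (0, adjoint B y)) = 0"
    by simp
  then show ?thesis
    by (simp only: linear_diff[OF positive_contraction_linear[OF P_contraction]]) simp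
qed

text \<open>With \<open>T = T_block A B\<close>, the entries of \<open>T\<^sup>* T\<close> are
  \<open>A\<^sup>* A\<close>, \<open>- A\<^sup>* B\<close>, \<open>- B\<^sup>* A\<close> and
  \<open>B\<^sup>* B\<close>, all in \<open>M\<close>. So \<open>P\<close> is a matrix over
  \<open>M\<close>.\<close>

lemma entry11_in_vN: "entry11 P \<in> M"
proof -
  note sot = sot_closed_algebra_vN[OF M]
  let ?N = "matrix_algebra M"
  have A': "adjoint A \<in> M" and B': "adjoint B \<in> M"
    using vN_adjoint[OF M] A B by auto
  have "(\<lambda>p. adjoint (T_block A B) (T_block A B p)) \<in> ?N"
  proof -
    have "(\<lambda>p. adjoint (T_block A B) (T_block A B p)) =
        block_op (adjoint A \<circ> A) (\<lambda>x. (-1) *\<^sub>R (adjoint A \<circ> B) x)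
          (\<lambda>x. (-1) *\<^sub>R (adjoint B \<circ> A) x) (adjoint B \<circ> B)"
      by (auto simp: adjoint_T_block T_block_apply block_op_def linear_diff bounded_linear.linear
          vN_bounded_linear[OF M] A' B')
    then show ?thesis
      unfolding matrix_algebra_def using A B A' B' sot_comp[OF sot] sot_scale[OF sot] by blast
  qed
  moreover have "sot_closed_algebra ?N"
    by (rule sot_closed_algebra_matrix[OF sot]) (rule vN_bounded_linear[OF M])
  ultimately have "P \<in> ?N"
    unfolding P_def by (intro null_proj(4)[OF T_block_clinear])
  then obtain a b c d where P: "P = block_op a b c d" "a \<in> M" "b \<in> M"
    unfolding matrix_algebra_def by blast
  have "entry11 P = a"
    using linear_0[OF bounded_linear.linear[OF vN_bounded_linear[OF M P(3)]]]
    by (simp add: fun_eq_iff entry11_def P(1) block_op_def)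
  then show ?thesis
    using P(2) by simp
qed

lemma entry11_inner: "inner (entry11 P x) y = inner (P (x, 0)) (y, 0)"
  by (simp add: entry11_def inner_prod_def)

lemma psd_entry11: "psd (entry11 P)"
  unfolding psd_def
proof (intro conjI allI)
  show "bounded_linear (entry11 P)"
    by (rule vN_bounded_linear[OF M entry11_in_vN])
  show "inner (entry11 P x) y = inner x (entry11 P y)" for x y
    using psd_sym[OF positive_contraction_psd[OF P_contraction], of "(x, 0)" "(y, 0)"]
    by (simp add: entry11_inner inner_commute[of x])  (simp add: inner_commute)
  show "0 \<le> inner (entry11 P x) x" for x
    by (simp add: entry11_inner flip: P_norm_sq)
qed

lemma adjoint_fst_P:
  "bounded_linear (\<lambda>p. fst (P p))" "adjoint (\<lambda>p. fst (P p)) = (\<lambda>x. P (x, 0))"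
proof -
  show "bounded_linear (\<lambda>p. fst (P p))"
    by (rule bounded_linear_compose[OF bounded_linear_fst
          psd_bounded_linear[OF positive_contraction_psd[OF P_contraction]]])
  have "inner (fst (P p)) x = inner p (P (x, 0))" for p x
    using psd_sym[OF positive_contraction_psd[OF P_contraction], of p "(x, 0)"] by (simp add: inner_prod_def)
  then show "adjoint (\<lambda>p. fst (P p)) = (\<lambda>x. P (x, 0))"
    by (intro adjoint_unique allI)
qed

section \<open>Range and factorisation of \<open>A \<circledcirc> B\<close>\<close>

lemma circledcirc_psd: "psd (A \<circledcirc> B)"
  and circledcirc_sqrt: "(A \<circledcirc> B) ((A \<circledcirc> B) x) = entry11 P x"
  and circledcirc_in_vN: "A \<circledcirc> B \<in> M"
  using sqrt_op_psd[OF vN_bounded_clinear[OF M entry11_in_vN] psd_entry11]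
    sot_closed_algebra_vN[OF M] entry11_in_vN
  unfolding circledcirc_def P_def[symmetric] by auto

lemma norm_circledcirc: "norm ((A \<circledcirc> B) x) = norm (P (x, 0))"
proof (rule power2_eq_imp_eq)
  show "(norm ((A \<circledcirc> B) x))\<^sup>2 = (norm (P (x, 0)))\<^sup>2"
    by (simp add: psd_norm_sq[OF circledcirc_psd] circledcirc_sqrt entry11_inner P_norm_sq)
qed simp_all

lemma range_circledcirc: "range (A \<circledcirc> B) = {x. A x \<in> range B}"
proof -
  note bl = psd_bounded_linear[OF circledcirc_psd] adjoint_fst_P(1)
  \<comment> \<open>The adjoints of the two maps have equal norms at every vector, so majorisation
    applies in both directions.\<close>
  have "range (A \<circledcirc> B) = range (\<lambda>p. fst (P p))"
    by (intro equalityI majorisation_range bl)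
      (simp_all add: adjoint_fst_P(2) adjoint_psd[OF circledcirc_psd] norm_circledcirc)
  also have "\<dots> = {x. A x \<in> range B}"
  proof (intro equalityI subsetI)
    fix x
    assume "x \<in> {x. A x \<in> range B}"
    then obtain y where "A x = B y" by auto
    then have "x = fst (P (x, y))"
      by (simp add: P_fixes)
    then show "x \<in> range (\<lambda>p. fst (P p))" by blast
  qed (use P_null in auto)
  finally show ?thesis .
qed

text \<open>With \<open>A2\<close> and \<open>B1\<close> for \<open>A\<close> and \<open>B\<close>,
  this makes \<open>(A1/B1) (A2 (A2 \<circledcirc> B1))\<close> the bounded operator
  \<open>A1 Z\<close>.\<close>

lemma circledcirc_factor:
  obtains Z where "Z \<in> M" and "\<And>x. A ((A \<circledcirc> B) x) = B (Z x)"
proof -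
  note sot = sot_closed_algebra_vN[OF M]
  have "A \<circ> (A \<circledcirc> B) \<in> M"
    by (rule sot_comp[OF sot A circledcirc_in_vN])
  moreover have "adjoint (A \<circ> (A \<circledcirc> B)) = (\<lambda>y. (A \<circledcirc> B) (adjoint A y))"
    by (rule adjoint_unique) (simp add: adjoint_hilbert[OF linear_AB(1)] psd_sym[OF circledcirc_psd])
  then have "norm (adjoint (A \<circ> (A \<circledcirc> B)) y) \<le> norm (adjoint B y)" for y
    using positive_contraction_norm[OF P_contraction, of "(0, adjoint B y)"]
    by (simp add: norm_circledcirc P_adjoint)
  ultimately obtain Z where "Z \<in> M" "\<And>x. (A \<circ> (A \<circledcirc> B)) x = B (Z x)"
    using vN_majorisation_factor[OF M B] by metis
  then show thesis
    using that by simp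
qed

section \<open>Range and factorisation of \<open>A \<boxdot> B\<close>\<close>

lemma boxdot_psd: "psd (A \<boxdot> B)"
  and boxdot_sqrt: "(A \<boxdot> B) ((A \<boxdot> B) x) = A (entry11 P (adjoint A x))"
  and boxdot_in_vN: "A \<boxdot> B \<in> M"
proof -
  note sot = sot_closed_algebra_vN[OF M]
  let ?Q = "A \<circ> entry11 P \<circ> adjoint A"
  have Q: "?Q \<in> M"
    by (intro sot_comp[OF sot] A entry11_in_vN vN_adjoint[OF M])
  have "psd ?Q"
    unfolding psd_def
  proof (intro conjI allI)
    show "bounded_linear ?Q"
      by (rule vN_bounded_linear[OF M Q])
    have eq: "inner (?Q x) y = inner (entry11 P (adjoint A x)) (adjoint A y)" for x y
      by (simp add: adjoint_hilbert[OF linear_AB(1)])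
    then show "inner (?Q x) y = inner x (?Q y)" for x y
      by (metis inner_commute psd_sym[OF psd_entry11])
    show "0 \<le> inner (?Q x) x" for x
      unfolding eq by (rule psd_nonneg[OF psd_entry11])
  qed
  note sqrt = sqrt_op_psd[OF vN_bounded_clinear[OF M Q] this]
  have eq: "A \<boxdot> B = sqrt_op ?Q"
    by (simp add: boxdot_def P_def cadjoint_eq_adjoint[OF vN_bounded_clinear[OF M A]])
  show "psd (A \<boxdot> B)" "(A \<boxdot> B) ((A \<boxdot> B) x) = A (entry11 P (adjoint A x))" "A \<boxdot> B \<in> M"
    unfolding eq using sqrt(1) sqrt(2)[of x] sqrt(3)[OF sot Q] by simp_all
qed

lemma norm_boxdot: "norm ((A \<boxdot> B) y) = norm (P (adjoint A y, 0))"
proof (rule power2_eq_imp_eq)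
  show "(norm ((A \<boxdot> B) y))\<^sup>2 = (norm (P (adjoint A y, 0)))\<^sup>2"
    by (simp add: psd_norm_sq[OF boxdot_psd] boxdot_sqrt adjoint_hilbert[OF linear_AB(1)]
        entry11_inner P_norm_sq)
qed simp_all

lemma range_boxdot: "range (A \<boxdot> B) = range A \<inter> range B"
proof -
  let ?G = "\<lambda>p. A (fst (P p))"
  have G: "bounded_linear ?G"
    by (rule bounded_linear_compose[OF linear_AB(1) adjoint_fst_P(1)])
  have adj: "adjoint ?G = (\<lambda>y. P (adjoint A y, 0))"
    by (rule adjoint_unique)
      (simp add: adjoint_hilbert[OF linear_AB(1)] adjoint_hilbert[OF adjoint_fst_P(1)] adjoint_fst_P(2))
  have "range (A \<boxdot> B) = range ?G"
    by (intro equalityI majorisation_range G psd_bounded_linear[OF boxdot_psd])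
      (simp_all add: adj adjoint_psd[OF boxdot_psd] norm_boxdot)
  also have "\<dots> = range A \<inter> range B"
  proof (intro equalityI subsetI)
    fix z
    assume "z \<in> range A \<inter> range B"
    then obtain x y where "z = A x" "A x = B y" by auto
    then have "z = ?G (x, y)"
      by (simp add: P_fixes)
    then show "z \<in> range ?G" by blast
  next
    fix z
    assume "z \<in> range ?G"
    then obtain p where "z = ?G p" by blast
    then have "z = A (fst (P p))" "z = B (snd (P p))"
      using P_null[of p] by simp_all
    then show "z \<in> range A \<inter> range B" by blast
  qed
  finally show ?thesis .
qed

text \<open>With \<open>B1\<close> and \<open>B2\<close> for \<open>A\<close> and \<open>B\<close>,
  the two terms of the numerator of the sum become \<open>A1 Z1\<close> and \<open>A2 Z2\<close>,
  which lie in \<open>M\<close>.\<close>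

lemma boxdot_factor:
  obtains Z1 Z2 where "Z1 \<in> M" and "Z2 \<in> M"
    and "\<And>x. (A \<boxdot> B) x = A (Z1 x)" and "\<And>x. (A \<boxdot> B) x = B (Z2 x)"
proof -
  note factor = vN_majorisation_factor[OF M _ boxdot_in_vN]
  have "norm (adjoint (A \<boxdot> B) y) \<le> norm (adjoint A y)" "norm (adjoint (A \<boxdot> B) y) \<le> norm (adjoint B y)" for y
    using positive_contraction_norm[OF P_contraction, of "(adjoint A y, 0)"]
      positive_contraction_norm[OF P_contraction, of "(0, adjoint B y)"]
    by (simp_all add: adjoint_psd[OF boxdot_psd] norm_boxdot P_adjoint)
  then obtain Z1 Z2 where "Z1 \<in> M" "Z2 \<in> M" "\<And>x. (A \<boxdot> B) x = A (Z1 x)" "\<And>x. (A \<boxdot> B) x = B (Z2 x)"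
    using factor[OF A] factor[OF B] by metis
  then show thesis
    by (rule that)
qed

end

section \<open>Sums and products of affiliated operators\<close>

context
  fixes M :: "('h::complex_hilbert \<Rightarrow> 'h) set" and A1 B1 A2 B2 :: "'h \<Rightarrow> 'h"
  assumes M: "von_neumann_algebra M"
    and mem: "A1 \<in> M" "B1 \<in> M" "A2 \<in> M" "B2 \<in> M"
    and null: "null B1 \<subseteq> null A1" "null B2 \<subseteq> null A2"
begin

private lemma quotient_values:
  "quotient A1 B1 (B1 x) = Some (A1 x)" "quotient A2 B2 (B2 x) = Some (A2 x)"
  using quotient_apply vN_bounded_clinear[OF M] mem null by blast+

text \<open>The numerator is \<open>A1 Z1 + A2 Z2\<close> with the two factors of
  \<open>B1 \<boxdot> B2\<close>, whose range is the common domain. The equation for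
  \<open>everywhere A\<close> includes that both composites are total.\<close>

lemma quotient_sum:
  obtains A where "A \<in> M" and "null (B1 \<boxdot> B2) \<subseteq> null A"
    and "everywhere A = unb_add (quotient A1 B1 \<circ>\<^sub>m everywhere (B1 \<boxdot> B2))
                                (quotient A2 B2 \<circ>\<^sub>m everywhere (B1 \<boxdot> B2))"
    and "unb_add (quotient A1 B1) (quotient A2 B2) = quotient A (B1 \<boxdot> B2)"
proof -
  note sot = sot_closed_algebra_vN[OF M]
  let ?B = "B1 \<boxdot> B2"
  have B: "?B \<in> M" and range: "range ?B = range B1 \<inter> range B2"
    using boxdot_in_vN range_boxdot M mem by blast+
  obtain Z1 Z2 where Z: "Z1 \<in> M" "Z2 \<in> M" "\<And>x. ?B x = B1 (Z1 x)" "\<And>x. ?B x = B2 (Z2 x)"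
    using boxdot_factor[OF M mem(2,4)] by metis
  have q: "quotient A1 B1 (?B x) = Some (A1 (Z1 x))" "quotient A2 B2 (?B x) = Some (A2 (Z2 x))" for x
    using quotient_values[of "Z1 x"] quotient_values[of "Z2 x"] Z(3)[of x] Z(4)[of x] by simp_all
  define A where "A = (\<lambda>x. (A1 \<circ> Z1) x + (A2 \<circ> Z2) x)"
  have A: "A \<in> M"
    unfolding A_def by (intro sot_add[OF sot] sot_comp[OF sot] mem Z)
  have nullA: "null ?B \<subseteq> null A"
  proof
    fix x
    assume "x \<in> null ?B"
    then have "Z1 x \<in> null B1" "Z2 x \<in> null B2"
      using Z(3)[of x] Z(4)[of x] by (simp_all add: null_def)
    then have "A1 (Z1 x) = 0" "A2 (Z2 x) = 0"
      using null by (auto simp: null_def)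
    then show "x \<in> null A"
      by (simp add: A_def null_def)
  qed
  have sum: "unb_add (quotient A1 B1) (quotient A2 B2) = quotient A ?B"
  proof
    fix z
    show "unb_add (quotient A1 B1) (quotient A2 B2) z = quotient A ?B z"
    proof (cases "z \<in> range ?B")
      case True
      then obtain x where z: "z = ?B x" by blast
      show ?thesis
        using quotient_apply[OF vN_bounded_clinear[OF M A] vN_bounded_clinear[OF M B] nullA, of x] True
        unfolding range by (simp add: unb_add_def dom_quotient z q A_def)
    next
      case False
      then have "z \<notin> dom (quotient A1 B1) \<inter> dom (quotient A2 B2)"
        by (simp add: dom_quotient range)
      then have "unb_add (quotient A1 B1) (quotient A2 B2) z = None"
        unfolding unb_add_def by (rule if_not_P)
      with False show ?thesis
        by (simp add: quotient_def)
    qed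
  qed
  have "everywhere A = unb_add (quotient A1 B1 \<circ>\<^sub>m everywhere ?B) (quotient A2 B2 \<circ>\<^sub>m everywhere ?B)"
    by (auto simp: fun_eq_iff everywhere_def unb_add_def map_comp_def q dom_def A_def)
  then show thesis
    using that A nullA sum by blast
qed

text \<open>The numerator is \<open>A1 Z\<close>, where \<open>B1 Z\<close> equals
  \<open>A2 (A2 \<circledcirc> B1)\<close>; the range of \<open>A2 \<circledcirc> B1\<close>
  consists of exactly the vectors that \<open>A2\<close> sends into the domain of the outer
  quotient.\<close>

lemma quotient_product:
  obtains A where "A \<in> M" and "null (B2 \<circ> (A2 \<circledcirc> B1)) \<subseteq> null A"
    and "everywhere A = quotient A1 B1 \<circ>\<^sub>m everywhere (A2 \<circ> (A2 \<circledcirc> B1))"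
    and "quotient A1 B1 \<circ>\<^sub>m quotient A2 B2 = quotient A (B2 \<circ> (A2 \<circledcirc> B1))"
proof -
  note sot = sot_closed_algebra_vN[OF M]
  let ?C = "A2 \<circledcirc> B1"
  let ?B = "B2 \<circ> ?C"
  have C: "?C \<in> M" and range: "range ?C = {x. A2 x \<in> range B1}"
    using circledcirc_in_vN range_circledcirc M mem by blast+
  have B: "?B \<in> M"
    by (intro sot_comp[OF sot] mem C)
  obtain Z where Z: "Z \<in> M" "\<And>x. A2 (?C x) = B1 (Z x)"
    using circledcirc_factor[OF M mem(3,2)] by metis
  define A where "A = A1 \<circ> Z"
  have A: "A \<in> M"
    unfolding A_def by (intro sot_comp[OF sot] mem Z)
  have nullA: "null ?B \<subseteq> null A"
  proof
    fix x
    assume "x \<in> null ?B"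
    then have "?C x \<in> null B2"
      by (simp add: null_def)
    \<comment> \<open>A vector killed by \<open>B2\<close> is killed by \<open>A2\<close>, so
      \<open>B1 (Z x) = A2 (?C x) = 0\<close>.\<close>
    then have "Z x \<in> null B1"
      using null(2) Z(2)[of x] by (auto simp: null_def)
    then show "x \<in> null A"
      using null(1) by (auto simp: A_def null_def)
  qed
  have prod: "quotient A1 B1 \<circ>\<^sub>m quotient A2 B2 = quotient A ?B"
  proof
    fix z
    show "(quotient A1 B1 \<circ>\<^sub>m quotient A2 B2) z = quotient A ?B z"
    proof (cases "z \<in> range ?B")
      case True
      then obtain x where z: "z = ?B x" by blast
      then show ?thesis
        using quotient_apply[OF vN_bounded_clinear[OF M A] vN_bounded_clinear[OF M B] nullA, of x]
        by (simp add: map_comp_def quotient_values Z(2) A_def)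
    next
      case False
      then have None: "quotient A ?B z = None"
        by (simp add: quotient_def)
      show ?thesis
      proof (cases "z \<in> range B2")
        case True
        then obtain x where z: "z = B2 x" by blast
        \<comment> \<open>Otherwise \<open>x\<close> would lie in the range of \<open>?C\<close>,
          and \<open>z = B2 x\<close> in that of \<open>?B\<close>.\<close>
        have "A2 x \<notin> range B1"
        proof
          assume "A2 x \<in> range B1"
          then have "x \<in> range ?C"
            by (simp add: range)
          with False z show False by auto
        qed
        then have "quotient A1 B1 (A2 x) = None"
          by (simp add: quotient_def)
        then show ?thesis
          unfolding None by (simp add: z map_comp_def quotient_values)
      next
        case False
        then show ?thesis
          unfolding None by (simp add: map_comp_def quotient_def)
      qed
    qed
  qed
  have "everywhere A = quotient A1 B1 \<circ>\<^sub>m everywhere (A2 \<circ> ?C)"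
    by (auto simp: fun_eq_iff everywhere_def map_comp_def Z(2) quotient_values A_def)
  then show thesis
    using that A nullA prod by blast
qed

end

theorem theorem4p8:
  fixes M :: "('h::complex_hilbert \<Rightarrow> 'h) set"
    and T1 T2 :: "'h \<rightharpoonup> 'h"
    and A1 B1 A2 B2 :: "'h \<Rightarrow> 'h"
  assumes "von_neumann_algebra M"
    and "T1 \<in> affiliated M" and "T2 \<in> affiliated M"
    and "A1 \<in> M" and "B1 \<in> M" and "A2 \<in> M" and "B2 \<in> M"
    and "null B1 \<subseteq> null A1" and "null B2 \<subseteq> null A2"
    and "T1 = quotient A1 B1" and "T2 = quotient A2 B2"
  shows "(unb_add T1 T2 \<in> affiliated M \<and>
      (\<exists>A\<in>M. \<exists>B\<in>M. null B \<subseteq> null A \<and>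
         everywhere A = unb_add (quotient A1 B1 \<circ>\<^sub>m everywhere (B1 \<boxdot> B2))
                                (quotient A2 B2 \<circ>\<^sub>m everywhere (B1 \<boxdot> B2)) \<and>
         B = B1 \<boxdot> B2 \<and>
         unb_add T1 T2 = quotient A B)) \<and>
      ((T1 \<circ>\<^sub>m T2) \<in> affiliated M \<and>
      (\<exists>A\<in>M. \<exists>B\<in>M. null B \<subseteq> null A \<and>
         everywhere A = quotient A1 B1 \<circ>\<^sub>m everywhere (A2 \<circ> (A2 \<circledcirc> B1)) \<and>
         B = B2 \<circ> (A2 \<circledcirc> B1) \<and>
         T1 \<circ>\<^sub>m T2 = quotient A B))"
proof -
  note mem = assms(4-7) and null = assms(8,9)
  have B: "B1 \<boxdot> B2 \<in> M" "B2 \<circ> (A2 \<circledcirc> B1) \<in> M"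
    using boxdot_in_vN[OF assms(1) mem(2,4)] circledcirc_in_vN[OF assms(1) mem(3,2)]
      sot_comp[OF sot_closed_algebra_vN[OF assms(1)] mem(4)] by auto
  obtain A where A: "A \<in> M" "null (B1 \<boxdot> B2) \<subseteq> null A"
    "everywhere A = unb_add (quotient A1 B1 \<circ>\<^sub>m everywhere (B1 \<boxdot> B2))
                            (quotient A2 B2 \<circ>\<^sub>m everywhere (B1 \<boxdot> B2))"
    "unb_add T1 T2 = quotient A (B1 \<boxdot> B2)"
    unfolding assms(10,11) by (rule quotient_sum[OF assms(1) mem null])
  obtain A' where A': "A' \<in> M" "null (B2 \<circ> (A2 \<circledcirc> B1)) \<subseteq> null A'"
    "everywhere A' = quotient A1 B1 \<circ>\<^sub>m everywhere (A2 \<circ> (A2 \<circledcirc> B1))"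
    "T1 \<circ>\<^sub>m T2 = quotient A' (B2 \<circ> (A2 \<circledcirc> B1))"
    unfolding assms(10,11) by (rule quotient_product[OF assms(1) mem null])
  have "unb_add T1 T2 \<in> affiliated M" "T1 \<circ>\<^sub>m T2 \<in> affiliated M"
    unfolding affiliated_def using A A' B by blast+
  with A A' B show ?thesis
    by blast
qed

end
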